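(* Let $(X_n : n\le 0)$ be a stationary $\{0,1\}$-valued process such that every cylinder set has strictly positive probability and $\mathbb{P}(i|\mathbf{x})>0$ for every $i\in\{0,1\}$ and every $\mathbf{x}\in\Sigma^{(-1)}$. Assume the process has complete connections, i.e. $\lim_{p\to\infty}\gamma_p=0$, where $(\gamma_p)_{p\ge 0}$ is the sequence defined in the context. If $$\sum_{\ell=0}^{\infty}\ \prod_{p=0}^{\ell}(1-\gamma_p)=\infty,$$ then the natural filtration $\mathcal{F}^X=(\mathcal{F}^X_n : n\le 0)$, $\mathcal{F}^X_n=\sigma(X_m : m\le n)$, is standard.
   Context: For $K\le 0$, $\Sigma^{(K)}=\prod_{n\le K}\{0,1\}$ is the set of $\{0,1\}$-valued sequences indexed by the integers $n\le K$. For a sequence $\mathbf{x}$, $\mathbf{x}[-p;-1]=(\mathbf{x}_{-p},\dots,\mathbf{x}_{-1})$. For $i\in\{0,1\}$ and $\mathbf{x}\in\Sigma^{(-1)}$, $\mathbb{P}(i|\mathbf{x})=\mathbb{P}(X_0=i\mid (X_n)_{n\le -1}=\mathbf{x})$ (a fixed version of the conditional probability, defined for every $\mathbf{x}$). For $p\ge 0$, $$\gamma_p=1-\inf\left\{\frac{\mathbb{P}(i|\mathbf{x})}{\mathbb{P}(i|\mathbf{y})} : i\in\{0,1\},\ \mathbf{x},\mathbf{y}\in\Sigma^{(-1)},\ \mathbf{x}[-p;-1]=\mathbf{y}[-p;-1]\right\},$$ where for $p=0$ there is no restriction on $\mathbf{x},\mathbf{y}\in\Sigma^{(-1)}$. Filtrations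 are indexed by the integers $n\le 0$, and $\sigma$-fields are considered up to null sets. A filtration $\mathcal{F}=(\mathcal{F}_n)_{n\le0}$ is immersed in a filtration $\mathcal{G}=(\mathcal{G}_n)_{n\le0}$ on the same probability space if $\mathcal{F}_n\subseteq\mathcal{G}_n$ for all $n$ and every $\mathcal{F}$-martingale is a $\mathcal{G}$-martingale. A filtration is of diffusive product type if it is the natural filtration $\mathcal{F}^W$, $\mathcal{F}^W_n=\sigma(W_m:m\le n)$, of a sequence $(W_n:n\le 0)$ of i.i.d. random variables uniformly distributed on $[0,1]$. A filtration $\mathcal{F}$ is standard if it can be immersed in a filtration of diffusive product type, possibly after enlarging the probability space or replacing $\mathcal{F}$ by an isomorphic copy; for $\mathcal{F}^X$ this means that on some probability space there is a process $X'$ with the same law as $X$ such that $\mathcal{F}^{X'}$ is immersed in a filtration of diffusive product type. *)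

theory Defs
  imports "HOL-Probability.Probability"
begin

text \<open>
  Processes and filtrations are indexed by the integers \<open>n \<le> 0\<close>: they are functions on type
  \<open>int\<close> whose values at positive indices never matter. A filtration on \<open>M\<close> is a family
  \<open>F :: int \<Rightarrow> 'a measure\<close> of which only the \<open>\<sigma>\<close>-fields \<open>sets (F n)\<close> are used.
\<close>

abbreviation binary :: "nat measure" where
  "binary \<equiv> count_space {0, 1}"

definition Seq :: "int \<Rightarrow> (int \<Rightarrow> nat) measure" where
  "Seq K = PiM {..K} (\<lambda>_. binary)"

definition path :: "(int \<Rightarrow> 'a \<Rightarrow> nat) \<Rightarrow> int \<Rightarrow> 'a \<Rightarrow> int \<Rightarrow> nat" where
  "path X K \<omega> = (\<lambda>n\<in>{..K}. X n \<omega>)"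

definition binary_process :: "'a measure \<Rightarrow> (int \<Rightarrow> 'a \<Rightarrow> nat) \<Rightarrow> bool" where
  "binary_process M X \<longleftrightarrow> (\<forall>n\<le>0. X n \<in> measurable M binary)"

definition process_law :: "'a measure \<Rightarrow> (int \<Rightarrow> 'a \<Rightarrow> nat) \<Rightarrow> (int \<Rightarrow> nat) measure" where
  "process_law M X = distr M (Seq 0) (path X 0)"

definition stationary :: "'a measure \<Rightarrow> (int \<Rightarrow> 'a \<Rightarrow> nat) \<Rightarrow> bool" where
  "stationary M X \<longleftrightarrow> (\<forall>k::nat. process_law M (\<lambda>n. X (n - int k)) = process_law M X)"

definition positive_cylinders :: "'a measure \<Rightarrow> (int \<Rightarrow> 'a \<Rightarrow> nat) \<Rightarrow> bool" where
  "positive_cylinders M X \<longleftrightarrow>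
     (\<forall>J x. finite J \<longrightarrow> J \<subseteq> {..0} \<longrightarrow> x \<in> J \<rightarrow> {0, 1} \<longrightarrow>
        0 < measure M {\<omega> \<in> space M. \<forall>n\<in>J. X n \<omega> = x n})"

definition natural_filtration ::
  "'a measure \<Rightarrow> 'b measure \<Rightarrow> (int \<Rightarrow> 'a \<Rightarrow> 'b) \<Rightarrow> int \<Rightarrow> 'a measure" where
  "natural_filtration M S X n =
     sigma (space M) (\<Union>m\<in>{..n}. {X m -` A \<inter> space M | A. A \<in> sets S})"

text \<open>
  \<open>g i x\<close> is a fixed version of the conditional probability that \<open>X\<^sub>0 = i\<close> given that
  \<open>(X\<^sub>n)\<close>, \<open>n \<le> -1\<close>, equals \<open>x\<close>. The relation \<open>g 0 x + g 1 x = 1\<close> is not imposed separately: it holds for almost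
  every \<open>x\<close>, hence for every \<open>x\<close> if \<open>g\<close> is continuous and all cylinders have positive probability.
\<close>

definition cond_prob_version ::
  "'a measure \<Rightarrow> (int \<Rightarrow> 'a \<Rightarrow> nat) \<Rightarrow> (nat \<Rightarrow> (int \<Rightarrow> nat) \<Rightarrow> real) \<Rightarrow> bool" where
  "cond_prob_version M X g \<longleftrightarrow>
     (\<forall>i\<in>{0, 1}. g i \<in> borel_measurable (Seq (-1)) \<and>
        (AE \<omega> in M. real_cond_exp M (natural_filtration M binary X (-1))
             (indicator {\<omega> \<in> space M. X 0 \<omega> = i}) \<omega> = g i (path X (-1) \<omega>)))"

definition gamma_coeff :: "(nat \<Rightarrow> (int \<Rightarrow> nat) \<Rightarrow> real) \<Rightarrow> nat \<Rightarrow> real" where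
  "gamma_coeff g p =
     1 - Inf {g i x / g i y | i x y. i \<in> {0, 1} \<and> x \<in> space (Seq (-1)) \<and> y \<in> space (Seq (-1)) \<and>
                (\<forall>n\<in>{- int p..-1}. x n = y n)}"

definition augment :: "'a measure \<Rightarrow> (int \<Rightarrow> 'a measure) \<Rightarrow> int \<Rightarrow> 'a measure" where
  "augment M F n = sigma (space M) (sets (F n) \<union> null_sets M)"

definition is_martingale :: "'a measure \<Rightarrow> (int \<Rightarrow> 'a measure) \<Rightarrow> (int \<Rightarrow> 'a \<Rightarrow> real) \<Rightarrow> bool" where
  "is_martingale M F Y \<longleftrightarrow>
     (\<forall>n\<le>0. integrable M (Y n) \<and> Y n \<in> borel_measurable (F n)) \<and>
     (\<forall>m n. m \<le> n \<longrightarrow> n \<le> 0 \<longrightarrow> (AE \<omega> in M. real_cond_exp M (F m) (Y n) \<omega> = Y m \<omega>))"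

text \<open>
  \<open>\<sigma>\<close>-fields are considered up to null sets, so both filtrations are augmented first.
\<close>

definition immersed :: "'a measure \<Rightarrow> (int \<Rightarrow> 'a measure) \<Rightarrow> (int \<Rightarrow> 'a measure) \<Rightarrow> bool" where
  "immersed M F G \<longleftrightarrow>
     (\<forall>n\<le>0. sets (augment M F n) \<subseteq> sets (augment M G n)) \<and>
     (\<forall>Y. is_martingale M (augment M F) Y \<longrightarrow> is_martingale M (augment M G) Y)"

definition iid_uniform :: "'a measure \<Rightarrow> (int \<Rightarrow> 'a \<Rightarrow> real) \<Rightarrow> bool" where
  "iid_uniform M W \<longleftrightarrow>
     prob_space.indep_vars M (\<lambda>_. borel) W {..0} \<and>
     (\<forall>n\<le>0. distr M borel (W n) = uniform_measure lborel {0..1})"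

definition diffusive_product_type :: "'a measure \<Rightarrow> (int \<Rightarrow> 'a measure) \<Rightarrow> bool" where
  "diffusive_product_type M G \<longleftrightarrow>
     (\<exists>W. iid_uniform M W \<and> G = natural_filtration M borel W)"

text \<open>
  Standardness of the natural filtration of \<open>X\<close>: some copy \<open>X'\<close> of \<open>X\<close> has its natural
  filtration immersed in one of diffusive product type. Since HOL cannot quantify over types inside
  a formula, the sample space of the copy is a set of sequences of pairs. This is no restriction:
  the properties of \<open>X'\<close> and of a sequence \<open>W\<close> generating the larger filtration depend only on
  their joint law, so that both can be realised as coordinate processes.
\<close>

definition standard_natural_filtration :: "'a measure \<Rightarrow> (int \<Rightarrow> 'a \<Rightarrow> nat) \<Rightarrow> bool" where
  "standard_natural_filtration M X \<longleftrightarrow>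
     (\<exists>(N :: (int \<Rightarrow> nat \<times> real) measure) X' G.
        prob_space N \<and> binary_process N X' \<and> process_law N X' = process_law M X \<and>
        diffusive_product_type N G \<and> immersed N (natural_filtration N binary X') G)"

end

theory Submission
  imports Defs "HOL-Library.Sublist"
begin

text \<open>
  Coupling from the past. Drive the chain with transition probability \<open>q = g 1\<close> by i.i.d. uniform
  variables \<open>W\<close>: the symbol at time \<open>n\<close> is 1 iff \<open>W n < q\<close>, evaluated at the past. If the last \<open>p\<close> symbols
  are known, then with probability at least \<open>1 - \<gamma>\<^sub>p\<close> the value of \<open>W\<close> determines the next one
  whatever the remaining past is. Start with no information at time \<open>-k\<close>, and let \<open>u k\<close> be the
  probability that nothing is known at time 0. Decomposing at the last time when nothing was known
  gives \<open>(\<Sum>j\<le>k. u (k - j) * (\<Prod>p<j. 1 - \<gamma>\<^sub>p)) \<le> 1\<close>; as \<open>u\<close> is decreasing, the divergence hypothesis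
  forces \<open>u k \<longlonglongrightarrow> 0\<close>. So the symbols are almost surely functions of \<open>W\<close>. The resulting process has
  the law of \<open>X\<close>, because starting the same dynamics from a past distributed as that of \<open>X\<close>
  reproduces this law at every time. Finally \<open>W n\<close> is independent of the past of \<open>W\<close>, so that
  conditioning on the past of \<open>W\<close> or on the past symbols gives the same law for the next symbol:
  this is immersion.
\<close>

section \<open>Immersion from one-step conditional independence\<close>

lemma sets_augment:
  assumes "subalgebra M (F n)"
  shows "space (augment M F n) = space M"
    and "sets (augment M F n) = sigma_sets (space M) (sets (F n) \<union> null_sets M)"
    and "subalgebra M (augment M F n)"
    and "sets (F n) \<subseteq> sets (augment M F n)"
proof -
  have sub: "sets (F n) \<union> null_sets M \<subseteq> Pow (space M)"
    using assms sets.sets_into_space unfolding subalgebra_def by fastforce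
  show "space (augment M F n) = space M"
    unfolding augment_def using sub by (simp add: space_measure_of_conv)
  show *: "sets (augment M F n) = sigma_sets (space M) (sets (F n) \<union> null_sets M)"
    unfolding augment_def using sub by simp
  show "subalgebra M (augment M F n)"
    unfolding subalgebra_def *
  proof
    show "space (augment M F n) = space M"
      unfolding augment_def using sub by (simp add: space_measure_of_conv)
    have "sets (F n) \<union> null_sets M \<subseteq> sets M"
      using assms by (auto simp: subalgebra_def)
    then show "sigma_sets (space M) (sets (F n) \<union> null_sets M) \<subseteq> sets M"
      by (rule sets.sigma_sets_subset)
  qed
  show "sets (F n) \<subseteq> sets (augment M F n)"
    unfolding * by auto
qed

lemma augment_mono:
  assumes "subalgebra M (F m)" "subalgebra M (G n)" "sets (F m) \<subseteq> sets (G n)"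
  shows "sets (augment M F m) \<subseteq> sets (augment M G n)"
  unfolding sets_augment(2)[where F=F, OF assms(1)] sets_augment(2)[where F=G, OF assms(2)]
  by (rule sigma_sets_mono') (use assms(3) in auto)

text \<open>The sets with such a representative contain the generators and are closed under
  complements and countable unions, so they exhaust the generated sigma-field. This reduces
  statements about augmented filtrations to the original ones.\<close>

lemma augment_ae_eq:
  assumes "subalgebra M (F n)" "A \<in> sets (augment M F n)"
  shows "\<exists>B\<in>sets (F n). AE \<omega> in M. \<omega> \<in> A \<longleftrightarrow> \<omega> \<in> B"
proof -
  have sp: "space (F n) = space M" using assms(1) by (simp add: subalgebra_def)
  have "A \<in> sigma_sets (space M) (sets (F n) \<union> null_sets M)"
    using assms sets_augment(2)[where F=F] by blast
  then show ?thesis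
  proof induction
    case (Basic a)
    then show ?case
    proof
      assume "a \<in> sets (F n)" then show ?thesis by (intro bexI[of _ a]) auto
    next
      assume "a \<in> null_sets M"
      then have "AE \<omega> in M. \<omega> \<notin> a" by (rule AE_not_in)
      then show ?thesis by (intro bexI[of _ "{}"]) auto
    qed
  next
    case Empty
    then show ?case by (intro bexI[of _ "{}"]) auto
  next
    case (Compl a)
    then obtain B where B: "B \<in> sets (F n)" "AE \<omega> in M. \<omega> \<in> a \<longleftrightarrow> \<omega> \<in> B" by auto
    have "space (F n) - B \<in> sets (F n)" using B by auto
    then show ?case using B sp by (intro bexI[of _ "space M - B"]) auto
  next
    case (Union a)
    then have "\<exists>B. \<forall>i. B i \<in> sets (F n) \<and> (AE \<omega> in M. \<omega> \<in> a i \<longleftrightarrow> \<omega> \<in> B i)"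
      by (intro choice) auto
    then obtain B where B: "\<And>i. B i \<in> sets (F n)" "\<And>i::nat. AE \<omega> in M. \<omega> \<in> a i \<longleftrightarrow> \<omega> \<in> B i"
      by blast
    have "AE \<omega> in M. \<forall>i::nat. \<omega> \<in> a i \<longleftrightarrow> \<omega> \<in> B i" using B(2) by (simp add: AE_all_countable)
    then have "AE \<omega> in M. \<omega> \<in> (\<Union>i. a i) \<longleftrightarrow> \<omega> \<in> (\<Union>i. B i)" by eventually_elim auto
    then show ?case using B(1) by (intro bexI[of _ "\<Union>i. B i"]) auto
  qed
qed

section \<open>Nested filtrations, conditional independence and martingales\<close>

locale nested_filtrations = prob_space M for M :: "'a measure" +
  fixes F G :: "int \<Rightarrow> 'a measure"
  assumes F_sub: "n \<le> 0 \<Longrightarrow> subalgebra M (F n)"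
    and G_sub: "n \<le> 0 \<Longrightarrow> subalgebra M (G n)"
    and F_mono: "m \<le> n \<Longrightarrow> n \<le> 0 \<Longrightarrow> sets (F m) \<subseteq> sets (F n)"
    and G_mono: "m \<le> n \<Longrightarrow> n \<le> 0 \<Longrightarrow> sets (G m) \<subseteq> sets (G n)"
    and F_le_G: "n \<le> 0 \<Longrightarrow> sets (F n) \<subseteq> sets (G n)"
    and one_step: "n \<le> 0 \<Longrightarrow> B \<in> sets (F n) \<Longrightarrow>
      \<exists>h\<in>borel_measurable (F (n - 1)). integrable M h \<and>
        (\<forall>A\<in>sets (G (n - 1)). (\<integral>\<omega>\<in>A. indicator B \<omega> \<partial>M) = (\<integral>\<omega>\<in>A. h \<omega> \<partial>M :: real))"
begin

lemma sigma_finite_sub: "subalgebra M H \<Longrightarrow> sigma_finite_subalgebra M H"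
  by (intro finite_measure_subalgebra_is_sigma_finite finite_measure_subalgebra.intro
      finite_measure_subalgebra_axioms.intro finite_measure_axioms)

lemma integrable_event: "A \<in> sets M \<Longrightarrow> integrable M (indicator A :: _ \<Rightarrow> real)"
  by (simp add: emeasure_eq_measure)

text \<open>
  The one-step hypothesis says that \<open>F n\<close> and \<open>G (n - 1)\<close> are conditionally independent given
  \<open>F (n - 1)\<close>; this is its symmetric counterpart.
\<close>

lemma cond_exp_G_event_step:
  assumes n: "n \<le> 0" and A: "A \<in> sets (G (n - 1))"
  shows "AE \<omega> in M. real_cond_exp M (F n) (indicator A) \<omega> = real_cond_exp M (F (n - 1)) (indicator A) \<omega>"
proof -
  interpret Fn: sigma_finite_subalgebra M "F n" using sigma_finite_sub F_sub n by blast
  interpret Fp: sigma_finite_subalgebra M "F (n - 1)" using sigma_finite_sub F_sub n by simp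
  have AM: "A \<in> sets M" using A G_sub[of "n - 1"] n by (auto simp: subalgebra_def)
  have sub: "subalgebra (F n) (F (n - 1))"
    using F_sub[of n] F_sub[of "n - 1"] F_mono[of "n - 1" n] n by (auto simp: subalgebra_def)
  show ?thesis
  proof (rule Fn.real_cond_exp_charact)
    fix B assume B: "B \<in> sets (F n)"
    then have BM: "B \<in> sets M" using F_sub n by (auto simp: subalgebra_def)
    obtain h where h: "h \<in> borel_measurable (F (n - 1))" "integrable M h"
      "\<And>A. A \<in> sets (G (n - 1)) \<Longrightarrow> (\<integral>\<omega>\<in>A. indicator B \<omega> \<partial>M) = (\<integral>\<omega>\<in>A. h \<omega> \<partial>M :: real)"
      using one_step[OF n B] by blast
    \<comment> \<open>The sets of \<open>F (n - 1)\<close> are among the test sets in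
      \<open>one_step\<close>, so \<open>h\<close> is also the conditional probability of
      \<open>B\<close> given \<open>F (n - 1)\<close>.\<close>
    have hE: "AE \<omega> in M. real_cond_exp M (F (n - 1)) (indicator B) \<omega> = h \<omega>"
      using h F_le_G[of "n - 1"] n BM by (intro Fp.real_cond_exp_charact) (auto simp: integrable_event)
    let ?eA = "real_cond_exp M (F (n - 1)) (indicator A) :: 'a \<Rightarrow> real"
    let ?eB = "real_cond_exp M (F (n - 1)) (indicator B) :: 'a \<Rightarrow> real"
    have AB: "integrable M (\<lambda>\<omega>. ?eB \<omega> * indicator A \<omega> :: real)"
      using integrable_mult_indicator[OF AM Fp.real_cond_exp_int(1)[OF integrable_event[OF BM]]]
      by (simp add: mult.commute)
    have BA: "integrable M (\<lambda>\<omega>. ?eA \<omega> * indicator B \<omega> :: real)"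
      using integrable_mult_indicator[OF BM Fp.real_cond_exp_int(1)[OF integrable_event[OF AM]]]
      by (simp add: mult.commute)
    \<comment> \<open>Conditional expectation given \<open>F (n - 1)\<close> is self-adjoint: the
      projection is moved from \<open>indicator B\<close> to \<open>indicator A\<close>, through the
      product of the two projections.\<close>
    have "(\<integral>\<omega>\<in>B. indicator A \<omega> \<partial>M) = (\<integral>\<omega>\<in>A. indicator B \<omega> \<partial>M :: real)"
      by (simp add: set_lebesgue_integral_def mult.commute)
    also have "\<dots> = (\<integral>\<omega>\<in>A. h \<omega> \<partial>M)" using h A by blast
    also have "\<dots> = (\<integral>\<omega>. ?eB \<omega> * indicator A \<omega> \<partial>M)"
      unfolding set_lebesgue_integral_def
      by (rule integral_cong_AE)
        (use hE h(2) AM in \<open>auto simp: mult.commute\<close>)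
    also have "\<dots> = (\<integral>\<omega>. ?eB \<omega> * ?eA \<omega> \<partial>M)"
      by (rule Fp.real_cond_exp_intg(2)[OF AB, symmetric]) (use AM in auto)
    also have "\<dots> = (\<integral>\<omega>. ?eA \<omega> * ?eB \<omega> \<partial>M)" by (simp add: mult.commute)
    also have "\<dots> = (\<integral>\<omega>. ?eA \<omega> * indicator B \<omega> \<partial>M)"
      by (rule Fp.real_cond_exp_intg(2)[OF BA]) (use BM in auto)
    also have "\<dots> = (\<integral>\<omega>\<in>B. ?eA \<omega> \<partial>M)"
      by (simp add: set_lebesgue_integral_def mult.commute)
    finally show "(\<integral>\<omega>\<in>B. indicator A \<omega> \<partial>M) = (\<integral>\<omega>\<in>B. ?eA \<omega> \<partial>M)" .
  next
    show "integrable M (indicator A :: 'a \<Rightarrow> real)" using AM by (rule integrable_event)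
    show "integrable M (real_cond_exp M (F (n - 1)) (indicator A))"
      using AM by (intro Fp.real_cond_exp_int integrable_event)
    show "real_cond_exp M (F (n - 1)) (indicator A) \<in> borel_measurable (F n)"
      by (rule measurable_from_subalg[OF sub]) simp
  qed
qed

text \<open>An event of \<open>G m\<close> belongs to all later \<open>G i\<close> by monotonicity,
  so the one-step identity can be chained from \<open>m\<close> up to \<open>n\<close>.\<close>

lemma cond_exp_G_event:
  assumes "m \<le> n" "n \<le> 0" and A: "A \<in> sets (G m)"
  shows "AE \<omega> in M. real_cond_exp M (F n) (indicator A) \<omega> = real_cond_exp M (F m) (indicator A) \<omega>"
  using assms(1,2)
proof (induction n rule: int_ge_induct)
  case base
  then show ?case by simp
next
  case (step i)
  have "A \<in> sets (G (i + 1 - 1))" using step G_mono[of m i] A by auto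
  from cond_exp_G_event_step[OF step(3) this] step
  show ?case by (auto elim: eventually_elim2)
qed

text \<open>Testing \<open>Y n\<close> on a set \<open>A\<close> of \<open>G m\<close> amounts to
  integrating it against the conditional probability of \<open>A\<close> given \<open>F n\<close>.
  As this equals the one given \<open>F m\<close>, \<open>Y n\<close> can be replaced by its
  projection \<open>Y m\<close>, and then the indicator of \<open>A\<close> is restored.\<close>

lemma martingale_G:
  assumes Y: "is_martingale M F Y"
  shows "is_martingale M G Y"
  unfolding is_martingale_def
proof (intro conjI allI impI)
  fix n :: int assume n: "n \<le> 0"
  show "integrable M (Y n)" using Y n by (auto simp: is_martingale_def)
  have "subalgebra (G n) (F n)" using F_sub[OF n] G_sub[OF n] F_le_G[OF n] by (auto simp: subalgebra_def)
  then show "Y n \<in> borel_measurable (G n)"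
    by (rule measurable_from_subalg) (use Y n in \<open>simp add: is_martingale_def\<close>)
next
  fix m n :: int assume mn: "m \<le> n" "n \<le> 0"
  then have m: "m \<le> 0" by simp
  interpret Fn: sigma_finite_subalgebra M "F n" using sigma_finite_sub F_sub mn by blast
  interpret Fm: sigma_finite_subalgebra M "F m" using sigma_finite_sub F_sub m by simp
  interpret Gm: sigma_finite_subalgebra M "G m" using sigma_finite_sub G_sub m by simp
  have Yn: "integrable M (Y n)" "Y n \<in> borel_measurable (F n)"
    and Ym: "integrable M (Y m)" "Y m \<in> borel_measurable (F m)"
    using Y mn m by (auto simp: is_martingale_def)
  have E: "AE \<omega> in M. real_cond_exp M (F m) (Y n) \<omega> = Y m \<omega>"
    using Y mn by (auto simp: is_martingale_def)
  show "AE \<omega> in M. real_cond_exp M (G m) (Y n) \<omega> = Y m \<omega>"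
  proof (rule Gm.real_cond_exp_charact)
    fix A assume A: "A \<in> sets (G m)"
    then have AM: "A \<in> sets M" using G_sub m by (auto simp: subalgebra_def)
    let ?eA = "real_cond_exp M (F m) (indicator A) :: 'a \<Rightarrow> real"
    have AE_eq: "AE \<omega> in M. real_cond_exp M (F n) (indicator A) \<omega> = ?eA \<omega>"
      by (rule cond_exp_G_event[OF mn A])
    have I1: "integrable M (\<lambda>\<omega>. Y n \<omega> * indicator A \<omega>)" "integrable M (\<lambda>\<omega>. Y m \<omega> * indicator A \<omega>)"
      using integrable_mult_indicator[OF AM Yn(1)] integrable_mult_indicator[OF AM Ym(1)]
      by (simp_all add: mult.commute)
    have I2: "integrable M (\<lambda>\<omega>. Y n \<omega> * real_cond_exp M (F n) (indicator A) \<omega>)"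
      by (rule Fn.real_cond_exp_intg(1)[OF I1(1) Yn(2)]) (use AM in auto)
    have I3: "integrable M (\<lambda>\<omega>. ?eA \<omega> * Y n \<omega>)"
      by (rule integrable_cong_AE_imp[OF I2])
        (use AE_eq Yn(1) in \<open>auto simp: mult.commute\<close>)
    have "(\<integral>\<omega>\<in>A. Y n \<omega> \<partial>M) = (\<integral>\<omega>. Y n \<omega> * indicator A \<omega> \<partial>M)"
      by (simp add: set_lebesgue_integral_def mult.commute)
    also have "\<dots> = (\<integral>\<omega>. Y n \<omega> * real_cond_exp M (F n) (indicator A) \<omega> \<partial>M)"
      by (rule Fn.real_cond_exp_intg(2)[OF I1(1) Yn(2), symmetric]) (use AM in auto)
    also have "\<dots> = (\<integral>\<omega>. ?eA \<omega> * Y n \<omega> \<partial>M)"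
      by (rule integral_cong_AE)
        (use AE_eq Yn(1) in \<open>auto simp: mult.commute\<close>)
    also have "\<dots> = (\<integral>\<omega>. ?eA \<omega> * real_cond_exp M (F m) (Y n) \<omega> \<partial>M)"
      by (rule Fm.real_cond_exp_intg(2)[OF I3, symmetric]) (use Yn in auto)
    also have "\<dots> = (\<integral>\<omega>. Y m \<omega> * ?eA \<omega> \<partial>M)"
      by (rule integral_cong_AE)
        (use E Ym(1) in \<open>auto simp: mult.commute\<close>)
    also have "\<dots> = (\<integral>\<omega>. Y m \<omega> * indicator A \<omega> \<partial>M)"
      by (rule Fm.real_cond_exp_intg(2)[OF I1(2) Ym(2)]) (use AM in auto)
    also have "\<dots> = (\<integral>\<omega>\<in>A. Y m \<omega> \<partial>M)"
      by (simp add: set_lebesgue_integral_def mult.commute)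
    finally show "(\<integral>\<omega>\<in>A. Y n \<omega> \<partial>M) = (\<integral>\<omega>\<in>A. Y m \<omega> \<partial>M)" .
  next
    have "subalgebra (G m) (F m)" using F_sub[OF m] G_sub[OF m] F_le_G[OF m] by (auto simp: subalgebra_def)
    then show "Y m \<in> borel_measurable (G m)" using Ym measurable_from_subalg by auto
  qed (use Yn Ym in auto)
qed

text \<open>\<open>immersed\<close> compares augmented filtrations, so the hypotheses have to
  survive augmentation. The same \<open>h\<close> works, since changing \<open>A\<close> and
  \<open>B\<close> on null sets changes neither integral.\<close>

lemma nested_filtrations_augment: "nested_filtrations M (augment M F) (augment M G)"
proof
  fix n :: int assume n: "n \<le> 0"
  show "subalgebra M (augment M F n)" "subalgebra M (augment M G n)"
    using F_sub G_sub n sets_augment(3) by blast+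
  show "sets (augment M F n) \<subseteq> sets (augment M G n)"
    using F_sub G_sub F_le_G n by (intro augment_mono) auto
  show "sets (augment M F m) \<subseteq> sets (augment M F n)" if "m \<le> n" for m
    using F_sub F_mono n that by (intro augment_mono) auto
  show "sets (augment M G m) \<subseteq> sets (augment M G n)" if "m \<le> n" for m
    using G_sub G_mono n that by (intro augment_mono) auto
  fix B assume BF: "B \<in> sets (augment M F n)"
  obtain B' where B': "B' \<in> sets (F n)" "AE \<omega> in M. \<omega> \<in> B \<longleftrightarrow> \<omega> \<in> B'"
    using augment_ae_eq[OF F_sub[OF n] BF] by blast
  obtain h where h: "h \<in> borel_measurable (F (n - 1))" "integrable M h"
    "\<And>A. A \<in> sets (G (n - 1)) \<Longrightarrow> (\<integral>\<omega>\<in>A. indicator B' \<omega> \<partial>M) = (\<integral>\<omega>\<in>A. h \<omega> \<partial>M :: real)"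
    using one_step[OF n B'(1)] by blast
  have sF: "subalgebra M (F (n - 1))" and sG: "subalgebra M (G (n - 1))"
    using F_sub G_sub n by auto
  have BM: "B \<in> sets M" "B' \<in> sets M"
    using BF B' F_sub[OF n] sets_augment(3)[where F=F, OF F_sub[OF n]] by (auto simp: subalgebra_def)
  show "\<exists>h\<in>borel_measurable (augment M F (n - 1)). integrable M h \<and>
        (\<forall>A\<in>sets (augment M G (n - 1)). (\<integral>\<omega>\<in>A. indicator B \<omega> \<partial>M) = (\<integral>\<omega>\<in>A. h \<omega> \<partial>M :: real))"
  proof (intro bexI[of _ h] conjI ballI)
    fix A assume A: "A \<in> sets (augment M G (n - 1))"
    obtain A' where A': "A' \<in> sets (G (n - 1))" "AE \<omega> in M. \<omega> \<in> A \<longleftrightarrow> \<omega> \<in> A'"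
      using augment_ae_eq[OF sG A] by blast
    have AM: "A \<in> sets M" "A' \<in> sets M"
      using A A' sG sets_augment(3)[where F=G, OF sG] by (auto simp: subalgebra_def)
    have "(\<integral>\<omega>\<in>A. indicator B \<omega> \<partial>M) = (\<integral>\<omega>\<in>A'. indicator B' \<omega> \<partial>M :: real)"
      unfolding set_lebesgue_integral_def
      by (rule integral_cong_AE)
        (use AM BM A'(2) B'(2) in \<open>auto simp: indicator_def\<close>)
    also have "\<dots> = (\<integral>\<omega>\<in>A'. h \<omega> \<partial>M)" using h A' by blast
    also have "\<dots> = (\<integral>\<omega>\<in>A. h \<omega> \<partial>M)"
      unfolding set_lebesgue_integral_def
      by (rule integral_cong_AE)
        (use AM h(2) A'(2) in \<open>auto simp: indicator_def\<close>)
    finally show "(\<integral>\<omega>\<in>A. indicator B \<omega> \<partial>M) = (\<integral>\<omega>\<in>A. h \<omega> \<partial>M)" .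
  next
    have "subalgebra (augment M F (n - 1)) (F (n - 1))"
      using sets_augment[where F=F, OF sF] sF by (auto simp: subalgebra_def)
    then show "h \<in> borel_measurable (augment M F (n - 1))"
      using h(1) measurable_from_subalg by blast
  qed (use h in auto)
qed

lemma immersed_FG: "immersed M F G"
proof -
  interpret aug: nested_filtrations M "augment M F" "augment M G"
    by (rule nested_filtrations_augment)
  show ?thesis
    unfolding immersed_def using aug.F_le_G aug.martingale_G by blast
qed

end

section \<open>Determined symbols\<close>

definition push :: "nat \<Rightarrow> (int \<Rightarrow> nat) \<Rightarrow> int \<Rightarrow> nat" where
  "push i x = (\<lambda>n\<in>{..-1}. if n = -1 then i else x (n + 1))"

text \<open>Words list the newest symbol first, so that a new symbol is a \<open>Cons\<close> and
  less information is a prefix. Pasts at any time are re-indexed to end at \<open>-1\<close>, so one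
  space carries them all.\<close>

definition cyl :: "nat list \<Rightarrow> (int \<Rightarrow> nat) set" where
  "cyl w = {x \<in> space (Seq (-1)). \<forall>i<length w. x (-1 - int i) = w ! i}"

lemma space_Seq: "space (Seq K) = {..K} \<rightarrow>\<^sub>E {0, 1}"
  by (simp add: Seq_def space_PiM)

lemma push_space: "i \<in> {0, 1} \<Longrightarrow> x \<in> space (Seq (-1)) \<Longrightarrow> push i x \<in> space (Seq (-1))"
  unfolding space_Seq push_def by (auto simp: PiE_iff)

lemma push_cyl: "i \<in> {0, 1} \<Longrightarrow> x \<in> cyl w \<Longrightarrow> push i x \<in> cyl (i # w)"
proof -
  assume i: "i \<in> {0, 1}" and x: "x \<in> cyl w"
  have "push i x (-1 - int j) = (i # w) ! j" if "j < length (i # w)" for j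
    using that x by (cases j) (auto simp: push_def cyl_def)
  then show ?thesis using push_space[OF i] x by (auto simp: cyl_def)
qed

text \<open>Padding the word with zeros gives a point. Nonemptiness keeps the infima and suprema
  over cylinders meaningful.\<close>

lemma cyl_nonempty:
  assumes "set w \<subseteq> {0, 1}"
  shows "cyl w \<noteq> {}"
proof -
  have "(\<lambda>n\<in>{..-1}. if nat (-1 - n) < length w then w ! nat (-1 - n) else 0) \<in> cyl w"
    using assms unfolding cyl_def space_Seq by (force simp: PiE_iff dest: nth_mem)
  then show ?thesis by blast
qed

lemma cyl_antimono: "prefix w w' \<Longrightarrow> cyl w' \<subseteq> cyl w"
  by (auto simp: cyl_def prefix_def nth_append)

lemma push_measurable:
  assumes "i \<in> {0, 1}"
  shows "push i \<in> measurable (Seq (-1)) (Seq (-1))"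
  unfolding push_def Seq_def
proof (rule measurable_restrict)
  fix n :: int assume "n \<in> {..-1}"
  then show "(\<lambda>x. if n = -1 then i else x (n + 1)) \<in> measurable (PiM {..-1} (\<lambda>_. binary)) binary"
    using assms by (cases "n = -1") (auto intro!: measurable_component_singleton)
qed

section \<open>A uniform variable as a biased coin\<close>

abbreviation unif :: "real measure" where
  "unif \<equiv> uniform_measure lborel {0..1}"

lemma prob_space_unif: "prob_space unif"
  by (rule prob_space_uniform_measure) auto

lemma emeasure_unif_less:
  assumes "0 \<le> c" "c \<le> 1"
  shows "emeasure unif {..<c} = ennreal c" "emeasure unif {c..} = ennreal (1 - c)"
proof -
  have "{0..1} \<inter> {..<c} = {0..<c}" "{0..1} \<inter> {c..} = {c..1}" using assms by auto
  then show "emeasure unif {..<c} = ennreal c" "emeasure unif {c..} = ennreal (1 - c)"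
    using assms by (simp_all add: divide_ennreal_def)

qed

lemma nn_integral_unif_threshold:
  assumes "0 \<le> c" "c \<le> 1"
  shows "(\<integral>\<^sup>+u. (if u < c then a else b) \<partial>unif) = ennreal c * a + ennreal (1 - c) * b"
proof -
  have "(\<integral>\<^sup>+u. (if u < c then a else b) \<partial>unif)
      = (\<integral>\<^sup>+u. a * indicator {..<c} u + b * indicator {c..} u \<partial>unif)"
    by (intro nn_integral_cong) (auto simp: indicator_def)
  also have "\<dots> = a * emeasure unif {..<c} + b * emeasure unif {c..}"
    by (subst nn_integral_add) (auto simp: nn_integral_cmult)
  finally show ?thesis by (simp only: emeasure_unif_less[OF assms] mult.commute)
qed

section \<open>Determined words and the limit process of a binary kernel\<close>

locale binary_kernel =
  fixes q :: "(int \<Rightarrow> nat) \<Rightarrow> real"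
  assumes q_meas [measurable]: "q \<in> borel_measurable (Seq (-1))"
    and q_ge0: "x \<in> space (Seq (-1)) \<Longrightarrow> 0 \<le> q x"
    and q_le1: "x \<in> space (Seq (-1)) \<Longrightarrow> q x \<le> 1"
begin

definition upd :: "(int \<Rightarrow> nat) \<Rightarrow> real \<Rightarrow> int \<Rightarrow> nat" where
  "upd x u = push (if u < q x then 1 else 0) x"

text \<open>Outside the interval from \<open>lo w\<close> to \<open>hi w\<close> a value of
  \<open>u\<close> decides the next symbol whatever the unknown part of the past; for a binary word
  the length of the interval is the chance of forgetting.\<close>

definition lo :: "nat list \<Rightarrow> real" where "lo w = Inf (q ` cyl w)"
definition hi :: "nat list \<Rightarrow> real" where "hi w = Sup (q ` cyl w)"

text \<open>
  A list \<open>w\<close> records the most recent symbols, newest first, as far as they are determined. The next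
  symbol is determined by \<open>u\<close> if all pasts extending \<open>w\<close> agree on it; otherwise all is forgotten.
\<close>

definition step :: "nat list \<Rightarrow> real \<Rightarrow> nat list" where
  "step w u = (if u < lo w then 1 # w else if hi w \<le> u then 0 # w else [])"

text \<open>Nothing is known at time \<open>s\<close>, and the last of the \<open>k\<close> updates
  uses \<open>W (s + int k)\<close>; the word thus describes the most recent symbols up to and
  including time \<open>s + int k\<close>.\<close>

primrec trail :: "(int \<Rightarrow> real) \<Rightarrow> int \<Rightarrow> nat \<Rightarrow> nat list" where
  "trail W s 0 = []"
| "trail W s (Suc k) = step (trail W s k) (W (s + int (Suc k)))"

lemma upd_space: "x \<in> space (Seq (-1)) \<Longrightarrow> upd x u \<in> space (Seq (-1))"
  by (simp add: upd_def push_space)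

lemma cyl_bdd: "bdd_below (q ` cyl w)" "bdd_above (q ` cyl w)"
  using q_ge0 q_le1 by (auto simp: cyl_def intro!: bdd_belowI[where m=0] bdd_aboveI[where M=1])

lemma lo_le: "x \<in> cyl w \<Longrightarrow> lo w \<le> q x"
  unfolding lo_def by (intro cInf_lower cyl_bdd) auto

lemma le_hi: "x \<in> cyl w \<Longrightarrow> q x \<le> hi w"
  unfolding hi_def by (intro cSup_upper cyl_bdd) auto

lemma lo_hi_range:
  assumes "set w \<subseteq> {0, 1}"
  shows "0 \<le> lo w" "lo w \<le> hi w" "hi w \<le> 1"
proof -
  obtain x where x: "x \<in> cyl w" using cyl_nonempty[OF assms] by auto
  show "0 \<le> lo w" unfolding lo_def using x q_ge0 by (intro cInf_greatest) (auto simp: cyl_def)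
  show "hi w \<le> 1" unfolding hi_def using x q_le1 by (intro cSup_least) (auto simp: cyl_def)
  show "lo w \<le> hi w" using lo_le[OF x] le_hi[OF x] by simp
qed

text \<open>A longer word leaves a smaller, still nonempty cylinder, so the undecided interval
  shrinks.\<close>

lemma lo_hi_mono:
  assumes "prefix w w'" "set w' \<subseteq> {0, 1}"
  shows "lo w \<le> lo w'" "hi w' \<le> hi w"
proof -
  have "q ` cyl w' \<noteq> {}" using cyl_nonempty[OF assms(2)] by auto
  moreover have "q ` cyl w' \<subseteq> q ` cyl w" using cyl_antimono[OF assms(1)] by auto
  ultimately show "lo w \<le> lo w'" "hi w' \<le> hi w"
    unfolding lo_def hi_def by (auto intro!: cInf_superset_mono cSup_subset_mono cyl_bdd)
qed

lemma step_set: "set w \<subseteq> {0, 1} \<Longrightarrow> set (step w u) \<subseteq> {0, 1}"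
  by (auto simp: step_def)

lemma trail_set: "set (trail W s k) \<subseteq> {0, 1}"
proof (induction k)
  case (Suc k)
  then show ?case unfolding trail.simps by (rule step_set)
qed simp

text \<open>Soundness of the word dynamics: a decision is taken only if every compatible past takes
  it too, and after forgetting every past is compatible.\<close>

lemma step_cyl:
  assumes "x \<in> cyl w"
  shows "upd x u \<in> cyl (step w u)"
proof -
  have "cyl [] = space (Seq (-1))" by (simp add: cyl_def)
  moreover have "x \<in> space (Seq (-1))" using assms by (simp add: cyl_def)
  ultimately show ?thesis
    using lo_le[OF assms] le_hi[OF assms] push_cyl[OF _ assms] upd_space[of x u]
    by (auto simp: step_def upd_def)
qed

text \<open>If the shorter word decides, the longer one decides likewise, because its undecided
  interval is contained in the other and \<open>lo w' \<le> hi w'\<close> excludes a conflict; if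
  the shorter one forgets, the empty word is a prefix of anything.\<close>

lemma step_mono:
  assumes "prefix w w'" "set w' \<subseteq> {0, 1}"
  shows "prefix (step w u) (step w' u)"
  using assms lo_hi_mono[OF assms] lo_hi_range[OF assms(2)] by (auto simp: step_def)

text \<open>An earlier start only adds information: at time \<open>s + 1\<close> the later start
  knows nothing, and \<open>step_mono\<close> carries the comparison forward.\<close>

lemma trail_Suc_start: "prefix (trail W (s + 1) k) (trail W s (Suc k))"
proof (induction k)
  case (Suc k)
  have "s + 1 + int (Suc k) = s + int (Suc (Suc k))" by simp
  then show ?case
    unfolding trail.simps(2)[of W "s + 1" k] trail.simps(2)[of W s "Suc k"]
    using step_mono[OF Suc trail_set] by metis
qed simp

lemma trail_mono: "j \<le> k \<Longrightarrow> prefix (trail W (n - int j) j) (trail W (n - int k) k)"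
proof (induction k rule: dec_induct)
  case (step k)
  have "n - int (Suc k) + 1 = n - int k" by simp
  then show ?case
    using trail_Suc_start[of W "n - int (Suc k)" k] step by (metis prefix_order.trans)
qed simp

text \<open>Any start that determines the symbol may be consulted, since all such starts agree. The
  value 0 also serves as default where no start does.\<close>

definition lim_symbol :: "(int \<Rightarrow> real) \<Rightarrow> int \<Rightarrow> nat" where
  "lim_symbol W n = (if \<exists>k. trail W (n - int k) k \<noteq> [] \<and> hd (trail W (n - int k) k) = 1 then 1 else 0)"

text \<open>The past includes time \<open>n\<close> itself, which sits at index \<open>-1\<close>
  after the shift.\<close>

definition lim_past :: "(int \<Rightarrow> real) \<Rightarrow> int \<Rightarrow> int \<Rightarrow> nat" where
  "lim_past W n = (\<lambda>j\<in>{..-1}. lim_symbol W (n + 1 + j))"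

text \<open>Trails ending at \<open>n\<close> are prefixes of one another, so nonempty ones share
  their head.\<close>

lemma lim_symbol_eq:
  assumes "trail W (n - int k) k \<noteq> []"
  shows "lim_symbol W n = hd (trail W (n - int k) k)"
proof -
  have *: "hd (trail W (n - int j) j) = hd (trail W (n - int k) k)" if "trail W (n - int j) j \<noteq> []" for j
    using trail_mono[of j k W n] trail_mono[of k j W n] assms that
    by (cases "j \<le> k") (auto simp: prefix_def)
  have "hd (trail W (n - int k) k) \<in> {0, 1}"
    using assms trail_set[of W "n - int k" k] by (meson hd_in_set subsetD)
  moreover have "(\<exists>j. trail W (n - int j) j \<noteq> [] \<and> hd (trail W (n - int j) j) = 1)
      \<longleftrightarrow> hd (trail W (n - int k) k) = 1"
    using * assms by metis
  ultimately show ?thesis unfolding lim_symbol_def by auto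
qed

lemma lim_past_space: "lim_past W n \<in> space (Seq (-1))"
  by (auto simp: lim_past_def space_Seq lim_symbol_def)

lemma lim_past_Suc: "lim_past W n = push (lim_symbol W n) (lim_past W (n - 1))"
  by (auto simp: lim_past_def push_def fun_eq_iff intro!: arg_cong[where f="lim_symbol W"])

text \<open>Holds for every input \<open>W\<close>, also where default values occur: after
  forgetting there is nothing to check, and otherwise the new head is the limit symbol by
  \<open>lim_symbol_eq\<close>.\<close>

lemma lim_past_cyl: "lim_past W (s + int k) \<in> cyl (trail W s k)"
proof (induction k)
  case 0
  then show ?case using lim_past_space by (simp add: cyl_def)
next
  case (Suc k)
  let ?n = "s + int (Suc k)"
  show ?case
  proof (cases "trail W s (Suc k) = []")
    case True
    then show ?thesis using lim_past_space by (simp only: cyl_def) simp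
  next
    case False
    then have eq: "trail W s (Suc k) = hd (trail W s (Suc k)) # trail W s k"
      by (auto simp: step_def split: if_splits)
    have "lim_symbol W ?n = hd
 (trail W s (Suc k))"
      using lim_symbol_eq[of W ?n "Suc k"] False by simp
    moreover have "lim_symbol W ?n \<in> {0, 1}" by (simp add: lim_symbol_def)
    moreover have "lim_past W (?n - 1) \<in> cyl (trail W s k)" using Suc by (simp add: algebra_simps)
    ultimately show ?thesis using push_cyl[of "lim_symbol W ?n"] lim_past_Suc[of W ?n] eq by metis
  qed
qed

text \<open>The word that decides the symbol at \<open>n\<close> is compatible with the limit past
  at \<open>n - 1\<close>; the threshold at that past lies between its \<open>lo\<close> and
  \<open>hi\<close>, hence makes the same decision.\<close>

lemma lim_past_upd:
  assumes "\<exists>k. trail W (n - int k) k \<noteq> []"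
  shows "lim_past W n = upd (lim_past W (n - 1)) (W n)"
proof -
  obtain k where k: "trail W (n - int k) k \<noteq> []" using assms by blast
  then obtain j where j: "k = Suc j" by (cases k) auto
  let ?w = "trail W (n - int k) j"
  have C: "lim_past W (n - 1) \<in> cyl ?w"
    using lim_past_cyl[of W "n - int k" j] j by simp
  have t: "trail W (n - int k) k = step ?w (W n)" using j by simp
  have "lim_symbol W n = hd (step ?w (W n))" using lim_symbol_eq[OF k] t by simp
  also have "\<dots> = (if W n < q (lim_past W (n - 1)) then 1 else 0)"
    using k t lo_le[OF C] le_hi[OF C] by (auto simp: step_def split: if_splits)
  finally show ?thesis using lim_past_Suc[of W n] by (simp add: upd_def)
qed

section \<open>Measurability and transition operators\<close>

lemma upd_measurable [measurable]:
  "(\<lambda>(x, u). upd x u) \<in> measurable (Seq (-1) \<Otimes>\<^sub>M borel) (Seq (-1))"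
proof -
  have [measurable]: "push 1 \<in> measurable (Seq (-1)) (Seq (-1))" "push 0 \<in> measurable (Seq (-1)) (Seq (-1))"
    by (auto intro!: push_measurable)
  have "(\<lambda>(x, u). upd x u) = (\<lambda>p. if snd p < q (fst p) then push 1 (fst p) else push 0 (fst p))"
    by (auto simp: upd_def)
  also have "\<dots> \<in> measurable (Seq (-1) \<Otimes>\<^sub>M borel) (Seq (-1))" by measurable
  finally show ?thesis .
qed

lemma step_measurable [measurable]: "step w \<in> measurable borel (count_space UNIV)"
  unfolding step_def[abs_def] by measurable

lemma trail_measurable:
  assumes "\<And>j. s < j \<Longrightarrow> j \<le> s + int k \<Longrightarrow> (\<lambda>\<omega>. W \<omega> j) \<in> borel_measurable M"
  shows "(\<lambda>\<omega>. trail (W \<omega>) s k) \<in> measurable M (count_space UNIV)"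
  using assms
proof (induction k)
  case (Suc k)
  have [measurable]: "(\<lambda>\<omega>. trail (W \<omega>) s k) \<in> measurable M (count_space UNIV)"
    using Suc by auto
  have [measurable]: "(\<lambda>\<omega>. W \<omega> (s + int (Suc k))) \<in> borel_measurable M"
    by (rule Suc) auto
  show ?case unfolding trail.simps
    by (rule measurable_compose_countable) measurable
qed simp

lemma lim_symbol_measurable:
  assumes "\<And>j. j \<le> n \<Longrightarrow> (\<lambda>\<omega>. W \<omega> j) \<in> borel_measurable M"
  shows "(\<lambda>\<omega>. lim_symbol (W \<omega>) n) \<in> measurable M binary"
proof -
  have [measurable]: "(\<lambda>\<omega>. trail (W \<omega>) (n - int k) k) \<in> measurable M (count_space UNIV)" for k
    using assms by (intro trail_measurable) auto
  have "(\<lambda>\<omega>. lim_symbol (W \<omega>) n) \<in> measurable M (count_space UNIV)"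
    unfolding lim_symbol_def by measurable
  then show ?thesis
    by (auto simp: lim_symbol_def measurable_count_space_eq2 intro!: measurable_count_space_eq2[THEN iffD2])
qed

text \<open>Markov transition operators, acting on nonnegative test functions, of the chain of
  determined words and, below, of the chain of pasts.\<close>

definition word_op :: "(nat list \<Rightarrow> ennreal) \<Rightarrow> nat list \<Rightarrow> ennreal" where
  "word_op h w = (\<integral>\<^sup>+u. h (step w u) \<partial>unif)"

definition past_op :: "((int \<Rightarrow> nat) \<Rightarrow> ennreal) \<Rightarrow> (int \<Rightarrow> nat) \<Rightarrow> ennreal" where
  "past_op f x = (\<integral>\<^sup>+u. f (upd x u) \<partial>unif)"

text \<open>Coupling: driven by the same \<open>u\<close>, a word and a compatible past stay
  compatible, so a comparison of test functions on compatible pairs survives every step.\<close>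

lemma word_op_le_past_op:
  assumes "\<And>w x. x \<in> cyl w \<Longrightarrow> h w \<le> f x" "x \<in> cyl w"
  shows "(word_op ^^ k) h w \<le> (past_op ^^ k) f x"
  using assms(2)
proof (induction k arbitrary: w x)
  case (Suc k)
  then show ?case
    by (auto simp: word_op_def past_op_def intro!: nn_integral_mono Suc step_cyl)
qed (use assms(1) in simp)

lemma past_op_measurable:
  assumes [measurable]: "f \<in> borel_measurable (Seq (-1))"
  shows "past_op f \<in> borel_measurable (Seq (-1))"
proof -
  interpret prob_space unif by (rule prob_space_unif)
  have "(\<lambda>(x, u). upd x u) \<in> measurable (Seq (-1) \<Otimes>\<^sub>M unif) (Seq (-1))"
    using upd_measurable by (simp cong: measurable_cong_sets sets_pair_measure_cong)
  from measurable_compose[OF this assms]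
  have "(\<lambda>(x, u). f (upd x u)) \<in> borel_measurable (Seq (-1) \<Otimes>\<^sub>M unif)"
    by (simp add: case_prod_beta')
  from borel_measurable_nn_integral[OF this] show ?thesis by (simp add: past_op_def[abs_def])
qed

lemma nn_integral_past_op_iterate:
  assumes "sets \<mu> = sets (Seq (-1))"
    and "\<And>f. f \<in> borel_measurable (Seq (-1)) \<Longrightarrow> (\<integral>\<^sup>+x. past_op f x \<partial>\<mu>) = (\<integral>\<^sup>+x. f x \<partial>\<mu>)"
    and "f \<in> borel_measurable (Seq (-1))"
  shows "(\<integral>\<^sup>+x. (past_op ^^ k) f x \<partial>\<mu>) = (\<integral>\<^sup>+x. f x \<partial>\<mu>)"
proof -
  have "(past_op ^^ k) f \<in> borel_measurable (Seq (-1)) \<and> ?thesis"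
    by (induction k) (auto simp: assms past_op_measurable)
  then show ?thesis ..
qed

lemma emeasure_step_nonempty:
  assumes "set w \<subseteq> {0, 1}"
  shows "emeasure unif {u. step w u \<noteq> []} = ennreal (1 - (hi w - lo w))"
proof -
  note r = lo_hi_range[OF assms]
  have "{u. step w u \<noteq> []} = {..<lo w} \<union> {hi w..}" using r by (auto simp: step_def)
  moreover have "emeasure unif ({..<lo w} \<union> {hi w..}) = emeasure unif {..<lo w} + emeasure unif {hi w..}"
    using r by (intro plus_emeasure[symmetric]) auto
  ultimately have "emeasure unif {u. step w u \<noteq> []} = ennreal (lo w) + ennreal (1 - hi w)"
    using emeasure_unif_less[of "lo w"] emeasure_unif_less[of "hi w"] r by simp
  also have "\<dots> = ennreal (1 - (hi w - lo w))"
    using r by (simp add: ennreal_plus[symmetric] del: ennreal_plus)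
  finally show ?thesis .
qed

end

section \<open>Coupling from the past\<close>

lemma natural_filtration_gen_subset:
  "(\<Union>m\<in>{..n}. {X m -` A \<inter> space M | A. A \<in> sets S}) \<subseteq> Pow (space M)"
  by auto

lemma space_natural_filtration: "space (natural_filtration M S X n) = space M"
  unfolding natural_filtration_def by (simp add: space_measure_of_conv)

lemma sets_natural_filtration:
  "sets (natural_filtration M S X n)
    = sigma_sets (space M) (\<Union>m\<in>{..n}. {X m -` A \<inter> space M | A. A \<in> sets S})"
  unfolding natural_filtration_def by (rule sets_measure_of[OF natural_filtration_gen_subset])

lemma natural_filtration_mono:
  "m \<le> n \<Longrightarrow> sets (natural_filtration M S X m) \<subseteq> sets (natural_filtration M S X n)"
  unfolding sets_natural_filtration by (rule sigma_sets_mono') force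

lemma natural_filtration_measurable:
  assumes "m \<le> n" "X m \<in> measurable M S"
  shows "X m \<in> measurable (natural_filtration M S X n) S"
proof (rule measurableI)
  fix A assume "A \<in> sets S"
  then have "X m -` A \<inter> space M \<in> (\<Union>m\<in>{..n}. {X m -` A \<inter> space M | A. A \<in> sets S})"
    using assms(1) by auto
  then show "X m -` A \<inter> space (natural_filtration M S X n) \<in> sets (natural_filtration M S X n)"
    unfolding space_natural_filtration sets_natural_filtration by (rule sigma_sets.Basic)
qed (use assms(2) in \<open>simp add: space_natural_filtration measurable_space\<close>)

lemma natural_filtration_subalgebra:
  assumes "\<And>m. m \<le> n \<Longrightarrow> X m \<in> measurable M' S" "space M' = space M"
  shows "subalgebra M' (natural_filtration M S X n)"
  unfolding subalgebra_def space_natural_filtration sets_natural_filtration assms(2)[symmetric]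
  by (intro conjI refl sets.sigma_sets_subset) (auto intro: measurable_sets assms(1))

text \<open>The sets of this form are a sigma-field, the one pulled back by the path map, and it
  makes every \<open>X m\<close> with \<open>m \<le> n\<close> measurable; so it contains the
  natural filtration.\<close>

lemma natural_filtration_preimage:
  assumes X: "\<And>m. m \<le> n \<Longrightarrow> X m \<in> measurable M S" and A: "A \<in> sets (natural_filtration M S X n)"
  shows "\<exists>C\<in>sets (PiM {..n} (\<lambda>_. S)). A = (\<lambda>\<omega>. \<lambda>i\<in>{..n}. X i \<omega>) -` C \<inter> space M"
proof -
  let ?R = "\<lambda>\<omega>. \<lambda>i\<in>{..n}. X i \<omega>" and ?P = "PiM {..n} (\<lambda>_. S)"
  have R: "?R \<in> measurable M ?P" using X by (intro measurable_restrict) auto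
  have R_sp: "?R \<in> space M \<rightarrow> space ?P" using measurable_space[OF R] by blast
  have "subalgebra (vimage_algebra (space M) ?R ?P) (natural_filtration M S X n)"
  proof (rule natural_filtration_subalgebra)
    fix m assume "m \<le> n"
    have "(\<lambda>\<omega>. ?R \<omega> m) \<in> measurable (vimage_algebra (space M) ?R ?P) S"
      using \<open>m \<le> n\<close>
      by (intro measurable_compose[OF measurable_vimage_algebra1[OF R_sp] measurable_component_singleton])
        simp
    then show "X m \<in> measurable (vimage_algebra (space M) ?R ?P) S" using \<open>m \<le> n\<close> by simp
  qed simp
  then have "A \<in> sets (vimage_algebra (space M) ?R ?P)" using A by (auto simp: subalgebra_def)
  then show ?thesis by (auto simp: sets_vimage_algebra2[OF R_sp])

qed

lemma prod_emb_PiE_eq: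
  "prod_emb I M J (Pi\<^sub>E J A) = {x \<in> space (PiM I M). \<forall>i\<in>J. x i \<in> A i}"
  by (auto simp: prod_emb_def space_PiM PiE_iff extensional_def)

section \<open>Dynamics driven by independent uniform variables\<close>

locale driven_kernel = binary_kernel q + prob_space N
  for q :: "(int \<Rightarrow> nat) \<Rightarrow> real" and N :: "'a measure" +
  fixes W :: "int \<Rightarrow> 'a \<Rightarrow> real"
  assumes iid: "iid_uniform N W"
begin

abbreviation W_alg :: "int \<Rightarrow> 'a measure" where "W_alg \<equiv> natural_filtration N borel W"
abbreviation tr :: "int \<Rightarrow> nat \<Rightarrow> 'a \<Rightarrow> nat list" where "tr s k \<omega> \<equiv> trail (\<lambda>n. W n \<omega>) s k"
abbreviation X_lim :: "int \<Rightarrow> 'a \<Rightarrow> nat" where "X_lim n \<omega> \<equiv> lim_symbol (\<lambda>n. W n \<omega>) n"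
abbreviation past_lim :: "int \<Rightarrow> 'a \<Rightarrow> int \<Rightarrow> nat" where "past_lim n \<omega> \<equiv> lim_past (\<lambda>n. W n \<omega>) n"
abbreviation X_alg :: "int \<Rightarrow> 'a measure" where "X_alg \<equiv> natural_filtration N binary X_lim"

lemma indep_W: "indep_vars (\<lambda>_. borel) W {..0}"
  and distr_W: "n \<le> 0 \<Longrightarrow> distr N borel (W n) = unif"
  using iid by (auto simp: iid_uniform_def)

lemma W_measurable: "n \<le> 0 \<Longrightarrow> W n \<in> borel_measurable N"
  using indep_W by (auto simp: indep_vars_def)

lemma W_alg_sub: "n \<le> 0 \<Longrightarrow> subalgebra N (W_alg n)"
  by (intro natural_filtration_subalgebra W_measurable) auto

lemma W_measurable_alg: "m \<le> n \<Longrightarrow> n \<le> 0 \<Longrightarrow> W m \<in> borel_measurable (W_alg n)"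
  by (intro natural_filtration_measurable W_measurable) auto

text \<open>An event on \<open>Z\<close> is an event on the block of inputs up to
  \<open>n - 1\<close>, which is independent of the block consisting of \<open>W n\<close>.
  Rectangles determine the product measure.\<close>

lemma joint_law:
  assumes n: "n \<le> 0" and Z: "Z \<in> measurable (W_alg (n - 1)) S"
  shows "distr N (S \<Otimes>\<^sub>M borel) (\<lambda>\<omega>. (Z \<omega>, W n \<omega>)) = distr N S Z \<Otimes>\<^sub>M unif"
proof (rule pair_measure_eqI[symmetric])
  have [measurable]: "W n \<in> borel_measurable N" using n W_measurable by simp
  have ZN [measurable]: "Z \<in> measurable N S" using measurable_from_subalg[OF W_alg_sub Z] n by simp
  show "sigma_finite_measure (distr N S Z)"
    by (intro prob_space_imp_sigma_finite prob_space_distr ZN)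
  show "sigma_finite_measure unif" by (intro prob_space_imp_sigma_finite prob_space_unif)
  show "sets (distr N S Z \<Otimes>\<^sub>M unif) = sets (distr N (S \<Otimes>\<^sub>M borel) (\<lambda>\<omega>. (Z \<omega>, W n \<omega>)))"
    by (simp cong: sets_pair_measure_cong)
  fix A B assume "A \<in> sets (distr N S Z)" "B \<in> sets unif"
  then have A [measurable]: "A \<in> sets S" and B [measurable]: "B \<in> sets borel" by auto
  let ?R = "\<lambda>\<omega>. \<lambda>i\<in>{..n-1}. W i \<omega>" and ?R' = "\<lambda>\<omega>. \<lambda>i\<in>{n}. W i \<omega>"
  let ?P = "\<lambda>I. PiM I (\<lambda>_. borel :: real measure)"
  have ZA: "Z -` A \<inter> space N \<in> sets (W_alg (n - 1))"
    using measurable_sets[OF Z A] by (simp add: space_natural_filtration)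
  have "\<exists>C\<in>sets (?P {..n-1}). Z -` A \<inter> space N = ?R -` C \<inter> space N"
    by (rule natural_filtration_preimage[OF _ ZA]) (use n W_measurable in auto)
  then obtain C where C: "C \<in> sets (?P {..n-1})" "Z -` A \<inter> space N = ?R -` C \<inter> space N"
    by blast

  \<comment> \<open>Independence of blocks is phrased for product spaces, so \<open>B\<close> is
    lifted to the product over the single index \<open>n\<close>.\<close>
  define B' where "B' = (\<lambda>f. f n) -` B \<inter> space (?P {n})"
  have B': "B' \<in> sets (?P {n})"
  proof -
    have "(\<lambda>f. f n) \<in> measurable (?P {n}) (borel :: real measure)"
      by (rule measurable_component_singleton) simp
    from measurable_sets[OF this B] show ?thesis unfolding B'_def .
  qed

  have B'_pre: "?R' -` B' \<inter> space N = W n -` B \<inter> space N"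
    by (auto simp: B'_def space_PiM)
  have "indep_var (?P {..n-1}) ?R (?P {n}) ?R'"
    by (rule indep_var_restrict[OF indep_W]) (use n in auto)
  from indep_varD[OF this C(1) B']
  have "prob ((\<lambda>\<omega>. (?R \<omega>, ?R' \<omega>)) -` (C \<times> B') \<inter> space N)
      = prob (Z -` A \<inter> space N) * prob (W n -` B \<inter> space N)"
    unfolding C(2) B'_pre .
  moreover have "(\<lambda>\<omega>. (?R \<omega>, ?R' \<omega>)) -` (C \<times> B') \<inter> space N = (?R -` C \<inter> space N) \<inter> (?R' -` B' \<inter> space N)"
    by auto
  moreover have "\<dots> = (\<lambda>\<omega>. (Z \<omega>, W n \<omega>)) -` (A \<times> B) \<inter> space N"
    unfolding C(2)[symmetric] B'_pre by auto
  ultimately have "emeasure N ((\<lambda>\<omega>. (Z \<omega>, W n \<omega>)) -` (A \<times> B) \<inter> space N)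
      = emeasure N (Z -` A \<inter> space N) * emeasure N (W n -` B \<inter> space N)"
    by (simp add: emeasure_eq_measure ennreal_mult)
  moreover have "emeasure N (W n -` B \<inter> space N) = emeasure unif B"
    unfolding distr_W[OF n, symmetric] by (simp add: emeasure_distr)
  ultimately show "emeasure (distr N S Z) A * emeasure unif B
      = emeasure (distr N (S \<Otimes>\<^sub>M borel) (\<lambda>\<omega>. (Z \<omega>, W n \<omega>))) (A \<times> B)"
    by (simp add: emeasure_distr)
qed

text \<open>The fresh input is integrated out with the past of \<open>W\<close> frozen; independence
  enters all later arguments in this form.\<close>

lemma nn_integral_joint:
  assumes n: "n \<le> 0" and Z: "Z \<in> measurable (W_alg (n - 1)) S"
    and f: "f \<in> borel_measurable (S \<Otimes>\<^sub>M borel)"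
  shows "(\<integral>\<^sup>+\<omega>. f (Z \<omega>, W n \<omega>) \<partial>N) = (\<integral>\<^sup>+\<omega>. (\<integral>\<^sup>+u. f (Z \<omega>, u) \<partial>unif) \<partial>N)"
proof -
  interpret U: prob_space unif by (rule prob_space_unif)
  have W: "W n \<in> borel_measurable N" using n W_measurable by simp
  have ZN: "Z \<in> measurable N S" using measurable_from_subalg[OF W_alg_sub Z] n by simp
  have f': "f \<in> borel_measurable (S \<Otimes>\<^sub>M unif)"
    using f by (simp cong: measurable_cong_sets sets_pair_measure_cong)
  have f'': "f \<in> borel_measurable (distr N S Z \<Otimes>\<^sub>M unif)"
    using f by (simp cong: measurable_cong_sets sets_pair_measure_cong)
  have "(\<integral>\<^sup>+\<omega>. f (Z \<omega>, W n \<omega>) \<partial>N)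
      = (\<integral>\<^sup>+p. f p \<partial>distr N (S \<Otimes>\<^sub>M borel) (\<lambda>\<omega>. (Z \<omega>, W n \<omega>)))"
    using f ZN W by (subst nn_integral_distr) auto
  also have "\<dots> = (\<integral>\<^sup>+z. (\<integral>\<^sup>+u. f (z, u) \<partial>unif) \<partial>distr N S Z)"
    unfolding joint_law[OF n Z] by (rule U.nn_integral_fst[OF f'', symmetric])
  also have "\<dots> = (\<integral>\<^sup>+\<omega>. (\<integral>\<^sup>+u. f (Z \<omega>, u) \<partial>unif) \<partial>N)"
    by (rule nn_integral_distr[OF ZN]) (use U.borel_measurable_nn_integral[of "\<lambda>z u. f (z, u)" S] f' in simp)
  finally show ?thesis .
qed

lemma tr_measurable: "s + int k \<le> n \<Longrightarrow> n \<le> 0 \<Longrightarrow> tr s k \<in> measurable (W_alg n) (count_space UNIV)"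
  by (intro trail_measurable W_measurable_alg) auto

lemma tr_measurable_N: "s + int k \<le> 0 \<Longrightarrow> tr s k \<in> measurable N (count_space UNIV)"
  by (intro trail_measurable W_measurable) auto

lemma nn_integral_tr_Suc:
  assumes "s + int (Suc k) \<le> 0"
  shows "(\<integral>\<^sup>+\<omega>. h (tr s (Suc k) \<omega>) \<partial>N) = (\<integral>\<^sup>+\<omega>. word_op h (tr s k \<omega>) \<partial>N)"
proof -
  let ?n = "s + int (Suc k)"
  have f: "(\<lambda>p. h (step (fst p) (snd p))) \<in> borel_measurable (count_space UNIV \<Otimes>\<^sub>M borel)"
    by (rule measurable_pair_measure_countable1)
      (auto intro!: measurable_compose[OF step_measurable])
  have t: "tr s k \<in> measurable (W_alg (?n - 1)) (count_space UNIV)"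
    using assms by (intro tr_measurable) auto
  show ?thesis
    using nn_integral_joint[OF assms t f] unfolding fst_conv snd_conv trail.simps word_op_def .

qed

text \<open>The right-hand side does not contain \<open>s\<close>: the law of the trail depends only
  on the number of steps, so runs from different starts can be compared.\<close>

lemma nn_integral_tr:
  "s + int k \<le> 0 \<Longrightarrow> (\<integral>\<^sup>+\<omega>. h (tr s k \<omega>) \<partial>N) = (word_op ^^ k) h []"
proof (induction k arbitrary: h)
  case 0
  then show ?case by (simp add: emeasure_space_1)
next
  case (Suc k)
  have "(\<integral>\<^sup>+\<omega>. h (tr s (Suc k) \<omega>) \<partial>N) = (\<integral>\<^sup>+\<omega>. word_op h (tr s k \<omega>) \<partial>N)"
    by (rule nn_integral_tr_Suc[OF Suc.prems])
  also have "\<dots> = (word_op ^^ k) (word_op h) []"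
    using Suc.prems by (intro Suc.IH) simp
  finally show ?case by (simp add: funpow_swap1)
qed

section \<open>The length of the determined word\<close>

definition len_prob :: "nat \<Rightarrow> nat \<Rightarrow> ennreal" where
  "len_prob k j = (word_op ^^ k) (\<lambda>w. if length w = j then 1 else 0) []"

text \<open>Any start may be chosen if the run ends by time 0; this freedom is why
  \<open>len_prob\<close> is defined by the operator rather than by \<open>W\<close>.\<close>

lemma len_prob_eq:
  "s + int k \<le> 0 \<Longrightarrow> len_prob k j = (\<integral>\<^sup>+\<omega>. (if length (tr s k \<omega>) = j then 1 else 0) \<partial>N)"
  unfolding len_prob_def by (rule nn_integral_tr[symmetric])

text \<open>A word of length \<open>Suc j\<close> can arise only by growth of a word of length
  \<open>j\<close>.\<close>

lemma len_prob_Suc_le: "len_prob (Suc k) (Suc j) \<le> len_prob k j"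
proof -
  let ?s = "- int (Suc k)"
  have "len_prob (Suc k) (Suc j) = (\<integral>\<^sup>+\<omega>. (if length (tr ?s (Suc k) \<omega>) = Suc j then 1 else 0) \<partial>N)"
    by (rule len_prob_eq) simp
  also have "\<dots> \<le> (\<integral>\<^sup>+\<omega>. (if length (tr ?s k \<omega>) = j then 1 else 0) \<partial>N)"
    by (intro nn_integral_mono) (auto simp: step_def split: if_splits)
  also have "\<dots> = len_prob k j" by (rule len_prob_eq[symmetric]) simp
  finally show ?thesis .
qed

text \<open>Both runs are made to end at time 0, one starting a step earlier than the other; the
  earlier start knows at least as much, so emptiness is rarer.\<close>

lemma len_prob_0_Suc: "len_prob (Suc k) 0 \<le> len_prob k 0"
proof -
  let ?s = "- int (Suc k)"
  have "len_prob (Suc k) 0 = (\<integral>\<^sup>+\<omega>. (if length (tr ?s (Suc k) \<omega>) = 0 then 1 else 0) \<partial>N)"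
    by (rule len_prob_eq) simp
  also have "\<dots> \<le> (\<integral>\<^sup>+\<omega>. (if length (tr (?s + 1) k \<omega>) = 0 then 1 else 0) \<partial>N)"
  proof (rule nn_integral_mono)
    fix \<omega>
    have "prefix (tr (?s + 1) k \<omega>) (tr ?s (Suc k) \<omega>)" by (rule trail_Suc_start)
    then show "(if length (tr ?s (Suc k) \<omega>) = 0 then 1 else 0) \<le> (if length (tr (?s + 1) k \<omega>) = 0 then 1 else 0 :: ennreal)"
      by (auto dest: prefix_length_le)
  qed
  also have "\<dots> = len_prob k 0" by (rule len_prob_eq[symmetric]) simp
  finally show ?thesis .
qed

lemma sum_len_prob_le_1: "(\<Sum>j\<in>J. len_prob k j) \<le> 1"
proof (cases "finite J")
  case True
  have m: "tr (- int k) k \<in> measurable N (count_space UNIV)" by (intro tr_measurable_N) simp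
  have "(\<Sum>j\<in>J. len_prob k j) = (\<Sum>j\<in>J. (\<integral>\<^sup>+\<omega>. (if length (tr (- int k) k \<omega>) = j then 1 else 0) \<partial>N))"
    by (intro sum.cong refl len_prob_eq) simp
  also have "\<dots> = (\<integral>\<^sup>+\<omega>. (\<Sum>j\<in>J. if length (tr (- int k) k \<omega>) = j then 1 else 0) \<partial>N)"
    by (intro nn_integral_sum[symmetric] measurable_compose[OF m]) simp
  also have "\<dots> \<le> (\<integral>\<^sup>+\<omega>. 1 \<partial>N)"
    using True by (intro nn_integral_mono) (simp add: sum.delta)
  finally show ?thesis by (simp add: emeasure_space_1)
qed simp

text \<open>From a word of length \<open>j\<close>, growth has conditional probability
  \<open>1 - (hi w - lo w)\<close>, hence at least \<open>c\<close>.\<close>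

lemma len_prob_Suc_ge:
  assumes "\<And>w. set w \<subseteq> {0, 1} \<Longrightarrow> length w = j \<Longrightarrow> c \<le> 1 - (hi w - lo w)"
  shows "ennreal c * len_prob k j \<le> len_prob (Suc k) (Suc j)"
proof -
  let ?s = "- int (Suc k)"
  have m: "tr ?s k \<in> measurable N (count_space UNIV)" by (intro tr_measurable_N) simp
  have "ennreal c * len_prob k j = ennreal c * (\<integral>\<^sup>+\<omega>. (if length (tr ?s k \<omega>) = j then 1 else 0) \<partial>N)"
    by (subst len_prob_eq[of ?s]) auto
  also have "\<dots> = (\<integral>\<^sup>+\<omega>. ennreal c * (if length (tr ?s k \<omega>) = j then 1 else 0) \<partial>N)"
    by (intro nn_integral_cmult[symmetric] measurable_compose[OF m]) simp
  also have "\<dots> \<le> (\<integral>\<^sup>+\<omega>. word_op (\<lambda>w. if length w = Suc j then 1 else 0) (tr ?s k \<omega>) \<partial>N)"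
  proof (rule nn_integral_mono)
    fix \<omega>
    let ?w = "tr ?s k \<omega>"
    show "ennreal c * (if length ?w = j then 1 else 0) \<le> word_op (\<lambda>w. if length w = Suc j then 1 else 0) ?w"
    proof (cases "length ?w = j")
      case True
      have [measurable]: "{u. step ?w u \<noteq> []} \<in> sets borel"
        unfolding step_def by measurable
      have "ennreal c \<le> emeasure unif {u. step ?w u \<noteq> []}"
        unfolding emeasure_step_nonempty[OF trail_set] using assms[OF trail_set True] by (rule ennreal_leI)
      also have "\<dots> = (\<integral>\<^sup>+u. indicator {u. step ?w u \<noteq> []} u \<partial>unif)" by simp
      also have "\<dots> \<le> word_op (\<lambda>w. if length w = Suc j then 1 else 0) ?w"
        unfolding word_op_def using True
        by (intro nn_integral_mono) (auto simp: indicator_def step_def)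
      finally show ?thesis using True by simp
    qed simp
  qed
  also have "\<dots> = len_prob (Suc k) (Suc j)"
    using nn_integral_tr_Suc[of ?s k "\<lambda>w. if length w = Suc j then 1 else 0"]
      len_prob_eq[of ?s "Suc k" "Suc j"]
    by (metis add.commute add.right_inverse order_refl)

  finally show ?thesis .
qed

end

section \<open>Almost sure determination of the symbols\<close>

text \<open>
  The trail is at least as likely to grow as the house-of-cards chain with success probabilities
  \<open>a p\<close>, and the hypothesis on \<open>a\<close> says that this chain is not positive recurrent.
\<close>

locale forgetful_kernel = driven_kernel q N W
  for q :: "(int \<Rightarrow> nat) \<Rightarrow> real" and N :: "'a measure" and W :: "int \<Rightarrow> 'a \<Rightarrow> real" +
  fixes a :: "nat \<Rightarrow> real"
  assumes a_ge0: "0 \<le> a p"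
    and a_osc: "set w \<subseteq> {0, 1} \<Longrightarrow> a (length w) \<le> 1 - (hi w - lo w)"
    and a_div: "(\<Sum>j. ennreal (\<Prod>p<j. a p)) = \<infinity>"
begin

text \<open>One way to know exactly \<open>j\<close> symbols after \<open>k + j\<close> steps is to
  know none after \<open>k\<close> and then to grow \<open>j\<close> times; the successive growth
  probabilities are at least \<open>a 0\<close>, ..., \<open>a (j - 1)\<close>.\<close>

lemma len_prob_ge: "ennreal (\<Prod>p<j. a p) * len_prob k 0 \<le> len_prob (k + j) j"
proof (induction j)
  case (Suc j)
  have "ennreal (\<Prod>p<Suc j. a p) * len_prob k 0 = ennreal (a j) * (ennreal (\<Prod>p<j. a p) * len_prob k 0)"
    by (simp add: ennreal_mult a_ge0 prod_nonneg mult_ac)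
  also have "\<dots> \<le> ennreal (a j) * len_prob (k + j) j" by (rule mult_left_mono[OF Suc]) simp
  also have "\<dots> \<le> len_prob (Suc (k + j)) (Suc j)"
    by (rule len_prob_Suc_ge) (use a_osc in auto)
  finally show ?case by simp
qed simp

lemma len_prob_0_decseq: "decseq (\<lambda>k. len_prob k 0)"
  by (intro decseq_SucI len_prob_0_Suc)

text \<open>Monotonicity of \<open>len_prob k 0\<close> in \<open>k\<close> replaces the renewal theorem.\<close>

lemma len_prob_0_tendsto: "(\<lambda>k. len_prob k 0) \<longlonglongrightarrow> 0"
proof -
  \<comment> \<open>By monotonicity the infimum is the limit, so it suffices to show that it
    vanishes.\<close>
  define c where "c = (INF k. len_prob k 0)"
  have "(\<Sum>j<n. c * ennreal (\<Prod>p<j. a p)) \<le> 1" for n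
  proof -
    \<comment> \<open>Length \<open>j\<close> at step \<open>n\<close> is bounded below by emptiness
      at step \<open>n - j\<close>, of probability at least \<open>c\<close>, followed by
      \<open>j\<close> growths. Different lengths exclude each other, so the sum stays below 1 for
      every \<open>n\<close>.\<close>
    have "(\<Sum>j<n. c * ennreal (\<Prod>p<j. a p)) \<le> (\<Sum>j<n. len_prob n j)"
    proof (rule sum_mono)
      fix j assume j: "j \<in> {..<n}"
      have "c * ennreal (\<Prod>p<j. a p) \<le> ennreal (\<Prod>p<j. a p) * len_prob (n - j) 0"
        unfolding c_def by (subst mult.commute) (intro mult_left_mono INF_lower, auto)
      also have "\<dots> \<le> len_prob n j" using len_prob_ge[of j "n - j"] j by simp
      finally show "c * ennreal (\<Prod>p<j. a p) \<le> len_prob n j" .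
    qed
    also have "\<dots> \<le> 1" by (rule sum_len_prob_le_1)
    finally show ?thesis .
  qed
  then have "(\<Sum>j. c * ennreal (\<Prod>p<j. a p)) \<le> 1" by (intro suminf_le_const) auto
  then have "c * \<infinity> \<le> 1" using a_div by simp
  then have "c = 0" by (cases "c = 0") (auto simp: ennreal_mult_top top_unique)
  then show ?thesis using LIMSEQ_INF[OF len_prob_0_decseq] by (simp add: c_def)
qed

text \<open>Length \<open>j\<close> requires an empty word \<open>j\<close> steps earlier.\<close>

lemma len_prob_tendsto: "(\<lambda>k. len_prob k j) \<longlonglongrightarrow> 0"
proof -
  have le: "len_prob (k + j) j \<le> len_prob k 0" for k
    by (induction j) (auto intro: order_trans[OF len_prob_Suc_le])
  have "(\<lambda>k. len_prob (k + j) j) \<longlonglongrightarrow> 0"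
    by (rule tendsto_sandwich[OF _ _ tendsto_const len_prob_0_tendsto])
      (intro always_eventually allI le zero_le)+

  then show ?thesis by (rule LIMSEQ_offset)
qed

text \<open>The event that every start fails lies, for each \<open>k\<close>, in the event that the
  start at \<open>n - int k\<close> fails, whose probability \<open>len_prob k 0\<close> tends to
  0.\<close>

lemma AE_tr_nonempty:
  assumes "n \<le> 0"
  shows "AE \<omega> in N. \<exists>k. tr (n - int k) k \<omega> \<noteq> []"
proof -
  have m [measurable]: "tr (n - int k) k \<in> measurable N (count_space UNIV)" for k
    using assms by (intro tr_measurable_N) simp
  let ?E = "{\<omega> \<in> space N. \<forall>k. tr (n - int k) k \<omega> = []}"
  have E: "?E \<in> sets N" by measurable
  have "emeasure N ?E \<le> len_prob k 0" for k
  proof -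
    have "emeasure N ?E = (\<integral>\<^sup>+\<omega>. indicator ?E \<omega> \<partial>N)" using E by simp
    also have "\<dots> \<le> (\<integral>\<^sup>+\<omega>. (if length (tr (n - int k) k \<omega>) = 0 then 1 else 0) \<partial>N)"
      by (intro nn_integral_mono) (auto simp: indicator_def)
    also have "\<dots> = len_prob k 0" using assms by (intro len_prob_eq[symmetric]) simp
    finally show ?thesis .
  qed
  then have "emeasure N ?E \<le> 0"
    using LIMSEQ_le_const[OF len_prob_0_tendsto] by blast
  then have "?E \<in> null_sets N" using E by (intro null_setsI) auto
  then show ?thesis by (rule AE_I') auto

qed

section \<open>The limit process: recursion, immersion and law\<close>

lemma AE_past_lim:
  assumes "n \<le> 0"
  shows "AE \<omega> in N. past_lim n \<omega> = upd (past_lim (n - 1) \<omega>) (W n \<omega>)"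
  using AE_tr_nonempty[OF assms] by eventually_elim (rule lim_past_upd)

lemma X_lim_measurable: "m \<le> n \<Longrightarrow> n \<le> 0 \<Longrightarrow> X_lim m \<in> measurable (W_alg n) binary"
  by (intro lim_symbol_measurable W_measurable_alg) auto

lemma X_lim_measurable_N: "n \<le> 0 \<Longrightarrow> X_lim n \<in> measurable N binary"
  by (intro lim_symbol_measurable W_measurable) auto

lemma past_lim_measurable_gen:
  assumes "\<And>m. m \<le> n \<Longrightarrow> X_lim m \<in> measurable H binary"
  shows "past_lim n \<in> measurable H (Seq (-1))"
  unfolding lim_past_def Seq_def using assms by (intro measurable_restrict) auto

lemma past_lim_measurable:
  assumes "n \<le> 0"
  shows "past_lim n \<in> measurable N (Seq (-1))" "past_lim n \<in> measurable (W_alg n) (Seq (-1))"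
    "past_lim n \<in> measurable (X_alg n) (Seq (-1))"
proof -
  show "past_lim n \<in> measurable N (Seq (-1))"
    using assms by (intro past_lim_measurable_gen X_lim_measurable_N) linarith
  show "past_lim n \<in> measurable (W_alg n) (Seq (-1))"
    using assms by (intro past_lim_measurable_gen X_lim_measurable)
  show "past_lim n \<in> measurable (X_alg n) (Seq (-1))"
    using assms by (intro past_lim_measurable_gen natural_filtration_measurable X_lim_measurable_N) linarith+
qed

lemma X_alg_sub: "n \<le> 0 \<Longrightarrow> subalgebra N (X_alg n)"
  by (intro natural_filtration_subalgebra X_lim_measurable_N) auto

lemma X_alg_le_W_alg: "n \<le> 0 \<Longrightarrow> sets (X_alg n) \<subseteq> sets (W_alg n)"
  using natural_filtration_subalgebra[of n X_lim "W_alg n" binary N] X_lim_measurable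
  by (auto simp: subalgebra_def space_natural_filtration)

text \<open>Shifting time by \<open>n + 1\<close> turns the path up to \<open>n\<close> into a point
  of \<open>Seq (-1)\<close>, so events of \<open>X_alg n\<close> become events on
  \<open>past_lim n\<close>.\<close>

lemma X_alg_preimage:
  assumes n: "n \<le> 0" and B: "B \<in> sets (X_alg n)"
  shows "\<exists>C\<in>sets (Seq (-1)). B = past_lim n -` C \<inter> space N"
proof -
  obtain C where C: "C \<in> sets (PiM {..n} (\<lambda>_. binary))"
    "B = (\<lambda>\<omega>. \<lambda>i\<in>{..n}. X_lim i \<omega>) -` C \<inter> space N"
    using natural_filtration_preimage[OF _ B] X_lim_measurable_N n by auto
  let ?\<tau> = "\<lambda>x. \<lambda>i\<in>{..n}. x (i - n - 1)"
  have \<tau>: "?\<tau> \<in> measurable (Seq (-1)) (PiM {..n} (\<lambda>_. binary))"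
    unfolding Seq_def by (intro measurable_restrict measurable_component_singleton) auto
  have eq: "(\<lambda>i\<in>{..n}. X_lim i \<omega>) = ?\<tau> (past_lim n \<omega>)" for \<omega>
    by (auto simp: lim_past_def fun_eq_iff)
  have "B = past_lim n -` (?\<tau> -` C \<inter> space (Seq (-1))) \<inter> space N"
    unfolding C(2) eq using lim_past_space by auto
  then show ?thesis using measurable_sets[OF \<tau> C(1)] by blast
qed

text \<open>Almost surely the past at \<open>n\<close> is obtained from the past at
  \<open>n - 1\<close> and the independent input \<open>W n\<close>. Integrating out this input
  leaves a function of the past symbols alone, even when tested on an event of the larger
  \<open>W_alg (n - 1)\<close>.\<close>

lemma X_alg_one_step:
  assumes n: "n \<le> 0" and B: "B \<in> sets (X_alg n)"
  shows "\<exists>h\<in>borel_measurable (X_alg (n - 1)). integrable N h \<and>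
    (\<forall>A\<in>sets (W_alg (n - 1)). (\<integral>\<omega>\<in>A. indicator B \<omega> \<partial>N) = (\<integral>\<omega>\<in>A. h \<omega> \<partial>N :: real))"
proof -
  obtain C where C [measurable]: "C \<in> sets (Seq (-1))" and BC: "B = past_lim n -` C \<inter> space N"
    using X_alg_preimage[OF n B] by blast
  define f where "f = past_op (indicator C)"
  have f_le: "f x \<le> 1" for x
  proof -
    interpret U: prob_space unif by (rule prob_space_unif)
    have "f x \<le> (\<integral>\<^sup>+u. 1 \<partial>unif)"
      unfolding f_def past_op_def by (intro nn_integral_mono) (auto simp: indicator_def)
    then show ?thesis using U.emeasure_space_1 by simp
  qed
  have f_meas [measurable]: "f \<in> borel_measurable (Seq (-1))"
    unfolding f_def by (intro past_op_measurable) simp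
  \<comment> \<open>The claim is about real integrals; no value is lost in the conversion because
    \<open>f\<close> is bounded by 1.\<close>
  define h where "h \<omega> = enn2real (f (past_lim (n - 1) \<omega>))" for \<omega>
  have n1: "n - 1 \<le> 0" using n by simp
  have h_X: "h \<in> borel_measurable (X_alg (n - 1))"
    unfolding h_def[abs_def] using measurable_compose[OF past_lim_measurable(3)[OF n1] f_meas] by simp
  have h_N [measurable]: "h \<in> borel_measurable N"
    using measurable_from_subalg[OF X_alg_sub[OF n1] h_X] .
  have h_eq: "ennreal (h \<omega>) = f (past_lim (n - 1) \<omega>)" for \<omega>
    unfolding h_def using f_le[of "past_lim (n - 1) \<omega>"]
    by (intro ennreal_enn2real) (auto simp: less_top[symmetric] top_unique)
  have h_range: "0 \<le> h \<omega>" "h \<omega> \<le> 1" for \<omega>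
  proof -
    show "0 \<le> h \<omega>" by (simp add: h_def)
    show "h \<omega> \<le> 1" using f_le[of "past_lim (n - 1) \<omega>"] unfolding h_eq[symmetric] by simp
  qed

  have BN: "B \<in> sets N" using B X_alg_sub[OF n] by (auto simp: subalgebra_def)
  show ?thesis
  proof (intro bexI[OF _ h_X] conjI ballI)
    show "integrable N h"
      by (rule integrable_const_bound[of _ 1]) (use h_range in auto)
    fix A assume A: "A \<in> sets (W_alg (n - 1))"
    then have AN [measurable]: "A \<in> sets N" using W_alg_sub[OF n1] by (auto simp: subalgebra_def)
    \<comment> \<open>The test set is carried along as an indicator, so that it is frozen together
      with the past when \<open>W n\<close> is integrated out.\<close>
    let ?Z = "\<lambda>\<omega>. (indicator A \<omega> :: ennreal, past_lim (n - 1) \<omega>)"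
    let ?g = "\<lambda>p. fst (fst p) * indicator C (upd (snd (fst p)) (snd p)) :: ennreal"
    have Z: "?Z \<in> measurable (W_alg (n - 1)) (borel \<Otimes>\<^sub>M Seq (-1))"
      using A past_lim_measurable(2)[OF n1] by (intro measurable_Pair borel_measurable_indicator)
    have "(\<lambda>p. upd (snd (fst p)) (snd p)) \<in> measurable ((borel \<Otimes>\<^sub>M Seq (-1)) \<Otimes>\<^sub>M borel) (Seq (-1))"
      by measurable
    then have g: "?g \<in> borel_measurable ((borel \<Otimes>\<^sub>M Seq (-1)) \<Otimes>\<^sub>M borel)"
      by (intro borel_measurable_times_ennreal) auto
    have "(\<integral>\<^sup>+\<omega>. indicator A \<omega> * indicator B \<omega> \<partial>N)
        = (\<integral>\<^sup>+\<omega>. indicator A \<omega> * indicator C (upd (past_lim (n - 1) \<omega>) (W n \<omega>)) \<partial>N)"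
      using AE_past_lim[OF n]
      by (intro nn_integral_cong_AE) (auto simp: BC indicator_def)
    also have "\<dots> = (\<integral>\<^sup>+\<omega>. (\<integral>\<^sup>+u. indicator A \<omega> * indicator C (upd (past_lim (n - 1) \<omega>) u) \<partial>unif) \<partial>N)"
      using nn_integral_joint[OF n Z g] by simp
    also have "\<dots> = (\<integral>\<^sup>+\<omega>. indicator A \<omega> * f (past_lim (n - 1) \<omega>) \<partial>N)"
      unfolding f_def past_op_def
      by (intro nn_integral_cong) (auto simp: indicator_def)
    also have "\<dots> = (\<integral>\<^sup>+\<omega>. ennreal (indicator A \<omega> * h \<omega>) \<partial>N)"
      by (intro nn_integral_cong) (auto simp: h_eq indicator_def)
    finally have *: "(\<integral>\<^sup>+\<omega>. ennreal (indicator A \<omega> * indicator B \<omega>) \<partial>N) = (\<integral>\<^sup>+\<omega>. ennreal (indicator A \<omega> * h \<omega>) \<partial>N)"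
      by (simp add: ennreal_mult' ennreal_indicator)
    show "(\<integral>\<omega>\<in>A. indicator B \<omega> \<partial>N) = (\<integral>\<omega>\<in>A. h \<omega> \<partial>N)"
      unfolding set_lebesgue_integral_def using * BN h_range
      by (simp add: integral_eq_nn_integral)
  qed
qed

lemma immersed_X_W: "immersed N X_alg W_alg"
proof -
  interpret nested_filtrations N X_alg W_alg
    by (rule nested_filtrations.intro[OF prob_space_axioms nested_filtrations_axioms.intro])
      (rule X_alg_sub W_alg_sub X_alg_le_W_alg natural_filtration_mono X_alg_one_step; assumption)+

  show ?thesis by (rule immersed_FG)
qed

text \<open>\<open>C\<close> depends on the \<open>m\<close> newest symbols, so a trail of length at
  least \<open>m\<close> decides it. Words forcing \<open>C\<close> are dominated by the chain of
  pasts started from the invariant law, which gives at most \<open>emeasure \<mu> C\<close>; shorter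
  words have vanishing probability.\<close>

lemma past_lim_event_le:
  assumes \<mu>: "prob_space \<mu>" "sets \<mu> = sets (Seq (-1))"
    and inv: "\<And>f. f \<in> borel_measurable (Seq (-1)) \<Longrightarrow> (\<integral>\<^sup>+x. past_op f x \<partial>\<mu>) = (\<integral>\<^sup>+x. f x \<partial>\<mu>)"
    and C: "C \<in> sets (Seq (-1))"
    and det: "\<And>x y. x \<in> C \<Longrightarrow> y \<in> space (Seq (-1)) \<Longrightarrow> (\<And>i. i < m \<Longrightarrow> x (-1 - int i) = y (-1 - int i)) \<Longrightarrow> y \<in> C"
  shows "emeasure (distr N (Seq (-1)) (past_lim 0)) C \<le> emeasure \<mu> C"
proof -
  interpret \<mu>: prob_space \<mu> by fact
  have P: "past_lim 0 \<in> measurable N (Seq (-1))" by (rule past_lim_measurable) simp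
  define h :: "nat list \<Rightarrow> ennreal" where "h w = (if m \<le> length w \<and> cyl w \<subseteq> C then 1 else 0)" for w
  have bound: "emeasure (distr N (Seq (-1)) (past_lim 0)) C \<le> emeasure \<mu> C + (\<Sum>j<m. len_prob k j)" for k
  proof -
    let ?t = "tr (- int k) k"
    have m: "?t \<in> measurable N (count_space UNIV)" by (intro tr_measurable_N) simp
    have "emeasure (distr N (Seq (-1)) (past_lim 0)) C = (\<integral>\<^sup>+\<omega>. indicator C (past_lim 0 \<omega>) \<partial>N)"
      using C nn_integral_distr[OF P, of "indicator C"] by simp

    also have "\<dots> \<le> (\<integral>\<^sup>+\<omega>. h (?t \<omega>) + (\<Sum>j<m. if length (?t \<omega>) = j then 1 else 0) \<partial>N)"
    proof (rule nn_integral_mono)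
      fix \<omega>
      have c: "past_lim 0 \<omega> \<in> cyl (?t \<omega>)" using lim_past_cyl[of "\<lambda>n. W n \<omega>" "- int k" k] by simp
      show "indicator C (past_lim 0 \<omega>) \<le> h (?t \<omega>) + (\<Sum>j<m. if length (?t \<omega>) = j then 1 else 0)"
      proof (cases "past_lim 0 \<omega> \<in> C \<and> m \<le> length (?t \<omega>)")
        case True
        have "cyl (?t \<omega>) \<subseteq> C"
          using det[of "past_lim 0 \<omega>"] c True by (auto simp: cyl_def)
        then show ?thesis using True by (simp add: h_def)
      qed (auto simp: indicator_def)
    qed
    also have "\<dots> = (\<integral>\<^sup>+\<omega>. h (?t \<omega>) \<partial>N) + (\<Sum>j<m. len_prob k j)"
    proof -
      have "(\<integral>\<^sup>+\<omega>. (\<Sum>j<m. if length (?t \<omega>) = j then 1 else 0) \<partial>N) = (\<Sum>j<m. len_prob k j)"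
        by (subst nn_integral_sum)
          (auto intro!: measurable_compose[OF m] sum.cong len_prob_eq[symmetric])
      then show ?thesis
        by (subst nn_integral_add) (auto intro!: measurable_compose[OF m] borel_measurable_sum)
    qed
    \<comment> \<open>The run starts with the empty word, which is compatible with every past; the
      expectation is a constant and may be averaged over \<open>\<mu>\<close>.\<close>
    also have "(\<integral>\<^sup>+\<omega>. h (?t \<omega>) \<partial>N) = (\<integral>\<^sup>+x. (word_op ^^ k) h [] \<partial>\<mu>)"
      by (subst nn_integral_tr) (simp_all add: \<mu>.emeasure_space_1)
    also have "\<dots> \<le> (\<integral>\<^sup>+x. (past_op ^^ k) (indicator C) x \<partial>\<mu>)"
    proof (intro nn_integral_mono word_op_le_past_op)
      show "x \<in> cyl []" if "x \<in> space \<mu>" for x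
        using that sets_eq_imp_space_eq[OF \<mu>(2)] by (simp add: cyl_def)
      show "h w \<le> indicator C x" if "x \<in> cyl w" for w x
        using that by (auto simp: h_def)
    qed
    also have "\<dots> = (\<integral>\<^sup>+x. indicator C x \<partial>\<mu>)"
      by (rule nn_integral_past_op_iterate[OF \<mu>(2) inv]) (use C in auto)
    also have "\<dots> = emeasure \<mu> C" using C \<mu>(2) by simp
    finally show ?thesis by (simp add: add_right_mono)
  qed
  have "(\<lambda>k. emeasure \<mu> C + (\<Sum>j<m. len_prob k j)) \<longlonglongrightarrow> emeasure \<mu> C + (\<Sum>j<m. 0)"
    by (intro tendsto_add tendsto_const tendsto_sum len_prob_tendsto)
  then show ?thesis using bound by (intro LIMSEQ_le_const) auto
qed

text \<open>Events on finitely many coordinates determine the law. The inequality for such an event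
  and for its complement forces equality, since both laws have mass 1.\<close>

lemma distr_past_lim:
  assumes \<mu>: "prob_space \<mu>" "sets \<mu> = sets (Seq (-1))"
    and inv: "\<And>f. f \<in> borel_measurable (Seq (-1)) \<Longrightarrow> (\<integral>\<^sup>+x. past_op f x \<partial>\<mu>) = (\<integral>\<^sup>+x. f x \<partial>\<mu>)"
  shows "distr N (Seq (-1)) (past_lim 0) = \<mu>"
proof -
  interpret \<mu>: prob_space \<mu> by fact
  let ?L = "distr N (Seq (-1)) (past_lim 0)"
  have P: "past_lim 0 \<in> measurable N (Seq (-1))" by (rule past_lim_measurable) simp
  interpret L: prob_space ?L by (rule prob_space_distr[OF P])
  show ?thesis
  proof (rule measure_eqI_PiM_infinite[where I="{..-1}" and M="\<lambda>_. binary"])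
    show "sets ?L = sets (PiM {..-1} (\<lambda>_. binary))" by (simp add: Seq_def)
    show "sets \<mu> = sets (PiM {..-1} (\<lambda>_. binary))" using \<mu> by (simp add: Seq_def)
    show "finite_measure ?L" by unfold_locales
    fix A :: "int \<Rightarrow> nat set" and J :: "int set"
    assume J: "finite J" "J \<subseteq> {..-1}" and A: "\<And>i. i \<in> J \<Longrightarrow> A i \<in> sets binary"
    let ?C = "prod_emb {..-1} (\<lambda>_. binary) J (Pi\<^sub>E J A)"
    have C: "?C \<in> sets (Seq (-1))" unfolding Seq_def
      using J A by (intro sets_PiM_I) auto
    have C_eq: "?C = {x \<in> space (Seq (-1)). \<forall>i\<in>J. x i \<in> A i}"
      by (simp add: prod_emb_PiE_eq Seq_def)
    \<comment> \<open>\<open>m\<close> exceeds the depth of every coordinate in \<open>J\<close>, so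
      the \<open>m\<close> newest symbols decide the event.\<close>
    obtain m where m: "\<And>i. i \<in> J \<Longrightarrow> nat (-1 - i) < m"
      using finite_nat_set_iff_bounded[of "(\<lambda>i. nat (-1 - i)) ` J"] J by auto
    have agree: "x i = y i" if "\<And>i. i < m \<Longrightarrow> x (-1 - int i) = y (-1 - int i)" "i \<in> J" for x y :: "int \<Rightarrow> nat" and i
      using that(1)[OF m[OF that(2)]] that(2) J by force
    have iff: "x \<in> ?C \<longleftrightarrow> y \<in> ?C"
      if "x \<in> space (Seq (-1))" "y \<in> space (Seq (-1))"
        "\<And>i. i < m \<Longrightarrow> x (-1 - int i) = y (-1 - int i)" for x y
    proof -
      have "x i = y i" if "i \<in> J" for i
        by (rule agree[OF _ that]) (rule \<open>\<And>i. i < m \<Longrightarrow> x (-1 - int i) = y (-1 - int i)\<close>)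
      then show ?thesis unfolding C_eq using that(1,2) by auto
    qed

    have C_sub: "?C \<subseteq> space (Seq (-1))" unfolding C_eq by blast
    have le: "emeasure ?L ?C \<le> emeasure \<mu> ?C"
      by (rule past_lim_event_le[OF \<mu> inv C, where m=m]) (use iff C_sub in blast)+
    have C': "space (Seq (-1)) - ?C \<in> sets (Seq (-1))" using C by auto
    have "emeasure ?L (space (Seq (-1)) - ?C) \<le> emeasure \<mu> (space (Seq (-1)) - ?C)"
      by (rule past_lim_event_le[OF \<mu> inv C', where m=m]) (use iff in blast)+

    then have "L.prob (space (Seq (-1)) - ?C) \<le> \<mu>.prob (space (Seq (-1)) - ?C)"
      by (simp add: L.emeasure_eq_measure \<mu>.emeasure_eq_measure)
    moreover have "L.prob (space (Seq (-1)) - ?C) = 1 - L.prob ?C"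
      using L.prob_compl[of ?C] C by simp
    moreover have "\<mu>.prob (space (Seq (-1)) - ?C) = 1 - \<mu>.prob ?C"
      using \<mu>.prob_compl[of ?C] C \<mu>(2) sets_eq_imp_space_eq[OF \<mu>(2)] by simp
    ultimately show "emeasure ?L ?C = emeasure \<mu> ?C"
      using le by (simp add: L.emeasure_eq_measure \<mu>.emeasure_eq_measure)
  qed
qed

end

section \<open>Processes with complete connections\<close>

locale complete_connections = prob_space M for M :: "'a measure" +
  fixes X :: "int \<Rightarrow> 'a \<Rightarrow> nat" and g :: "nat \<Rightarrow> (int \<Rightarrow> nat) \<Rightarrow> real"
  assumes bin: "binary_process M X"
    and stat: "stationary M X"
    and pos_cyl: "positive_cylinders M X"
    and version: "cond_prob_version M X g"
    and g_pos: "i \<in> {0, 1} \<Longrightarrow> x \<in> space (Seq (-1)) \<Longrightarrow> 0 < g i x"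
    and gamma_lim: "gamma_coeff g \<longlonglongrightarrow> 0"
    and gamma_div: "(\<Sum>l. ennreal (\<Prod>p=0..l. 1 - gamma_coeff g p)) = \<infinity>"
begin

abbreviation "past \<equiv> path X (-1)"
abbreviation "past_alg \<equiv> natural_filtration M binary X (-1)"

lemma X_meas: "n \<le> 0 \<Longrightarrow> X n \<in> measurable M binary"
  using bin by (simp add: binary_process_def)

lemma X_bin: "n \<le> 0 \<Longrightarrow> \<omega> \<in> space M \<Longrightarrow> X n \<omega> \<in> {0, 1}"
  using measurable_space[OF X_meas] by simp

lemma path_meas: "K \<le> 0 \<Longrightarrow> path X K \<in> measurable M (Seq K)"
  unfolding path_def Seq_def by (intro measurable_restrict X_meas) auto

lemma past_space: "\<omega> \<in> space M \<Longrightarrow> past \<omega> \<in> space (Seq (-1))"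
  using measurable_space[OF path_meas] by simp

lemma past_alg_sub: "subalgebra M past_alg"
  by (intro natural_filtration_subalgebra X_meas) auto

lemma past_meas_alg: "past \<in> measurable past_alg (Seq (-1))"
  unfolding path_def Seq_def
  by (intro measurable_restrict natural_filtration_measurable X_meas) auto

lemma sigma_finite_past_alg: "sigma_finite_subalgebra M past_alg"
  by (intro finite_measure_subalgebra_is_sigma_finite finite_measure_subalgebra.intro
      finite_measure_subalgebra_axioms.intro finite_measure_axioms past_alg_sub)

lemma g_meas: "i \<in> {0, 1} \<Longrightarrow> g i \<in> borel_measurable (Seq (-1))"
  and g_version: "i \<in> {0, 1} \<Longrightarrow>
    AE \<omega> in M. real_cond_exp M past_alg (indicator {\<omega> \<in> space M. X 0 \<omega> = i}) \<omega> = g i (past \<omega>)"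
  using version unfolding cond_prob_version_def by blast+

lemma event_sets: "i \<in> {0, 1} \<Longrightarrow> {\<omega> \<in> space M. X 0 \<omega> = i} \<in> sets M"
proof -
  assume "i \<in> {0, 1}"
  then have "X 0 -` {i} \<inter> space M \<in> sets M" using X_meas[of 0] by (intro measurable_sets) auto
  moreover have "X 0 -` {i} \<inter> space M = {\<omega> \<in> space M. X 0 \<omega> = i}" by auto
  ultimately show ?thesis by simp
qed

lemma space_Seq_nonempty: "\<exists>x. x \<in> space (Seq (-1))"
  using not_empty past_space by blast

text \<open>\<open>Inf\<close> on the reals calls for a nonempty set bounded below: positivity of
  \<open>g\<close> supplies the bound 0, and \<open>x = y\<close> supplies the member 1, which also
  caps the infimum.\<close>

lemma ratio_Inf:
  shows "0 \<le> 1 - gamma_coeff g p" "1 - gamma_coeff g p \<le> 1"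
    and "i \<in> {0, 1} \<Longrightarrow> x \<in> space (Seq (-1)) \<Longrightarrow> y \<in> space (Seq (-1)) \<Longrightarrow>
      (\<And>n. n \<in> {- int p..-1} \<Longrightarrow> x n = y n) \<Longrightarrow> (1 - gamma_coeff g p) * g i y \<le> g i x"
proof -
  let ?R = "{g i x / g i y | i x y. i \<in> {0, 1} \<and> x \<in> space (Seq (-1)) \<and> y \<in> space (Seq (-1)) \<and>
    (\<forall>n\<in>{- int p..-1}. x n = y n)}"
  have Inf: "1 - gamma_coeff g p = Inf ?R" by (simp add: gamma_coeff_def)
  have ge0: "\<And>r. r \<in> ?R \<Longrightarrow> 0 \<le> r" using g_pos by (force intro: divide_nonneg_nonneg less_imp_le)
  have bdd: "bdd_below ?R" using ge0 by (rule bdd_belowI)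
  obtain z where z: "z \<in> space (Seq (-1))" using space_Seq_nonempty by blast
  have "g 0 z / g 0 z \<in> ?R" using z by blast
  then have one: "1 \<in> ?R" using g_pos[of 0 z] z by simp
  show "0 \<le> 1 - gamma_coeff g p" unfolding Inf using one ge0 by (intro cInf_greatest) auto
  show "1 - gamma_coeff g p \<le> 1" unfolding Inf using one bdd by (rule cInf_lower)
  assume a: "i \<in> {0, 1}" "x \<in> space (Seq (-1))" "y \<in> space (Seq (-1))"
    and "\<And>n. n \<in> {- int p..-1} \<Longrightarrow> x n = y n"
  then have "g i x / g i y \<in> ?R" by blast
  then have "1 - gamma_coeff g p \<le> g i x / g i y" unfolding Inf using bdd by (rule cInf_lower)
  then show "(1 - gamma_coeff g p) * g i y \<le> g i x"
    using g_pos[OF a(1,3)] by (simp add: pos_le_divide_eq)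
qed

text \<open>The two values of \<open>X 0\<close> partition the sample space, and conditional
  expectation is linear.\<close>

lemma AE_g_sum: "AE \<omega> in M. g 0 (past \<omega>) + g 1 (past \<omega>) = 1"
proof -
  interpret P: sigma_finite_subalgebra M past_alg by (rule sigma_finite_past_alg)
  let ?E = "\<lambda>i. {\<omega> \<in> space M. X 0 \<omega> = i}"
  have E: "?E 0 \<in> sets M" "?E 1 \<in> sets M" using event_sets by auto
  have int: "integrable M (indicator (?E 0) :: 'a \<Rightarrow> real)" "integrable M (indicator (?E 1) :: 'a \<Rightarrow> real)"
    using E by (auto simp: emeasure_eq_measure)
  have eq: "AE \<omega> in M. indicator (?E 0) \<omega> + indicator (?E 1) \<omega> = (1 :: real)"
    using X_bin[of 0] by (intro AE_I2) (auto simp: indicator_def)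
  have "AE \<omega> in M. real_cond_exp M past_alg (\<lambda>\<omega>. indicator (?E 0) \<omega> + indicator (?E 1) \<omega>) \<omega>
      = real_cond_exp M past_alg (\<lambda>_. 1) \<omega>"
    by (rule P.real_cond_exp_cong[OF eq]) (use E in auto)
  moreover have "AE \<omega> in M. real_cond_exp M past_alg (\<lambda>_. 1) \<omega> = 1"
    by (rule P.real_cond_exp_F_meas) auto
  moreover have "AE \<omega> in M. real_cond_exp M past_alg (\<lambda>\<omega>. indicator (?E 0) \<omega> + indicator (?E 1) \<omega>) \<omega>
      = real_cond_exp M past_alg (indicator (?E 0)) \<omega> + real_cond_exp M past_alg (indicator (?E 1)) \<omega>"
    by (rule P.real_cond_exp_add[OF int])
  moreover have "AE \<omega> in M. real_cond_exp M past_alg (indicator (?E 0)) \<omega> = g 0 (past \<omega>)"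
    "AE \<omega> in M. real_cond_exp M past_alg (indicator (?E 1)) \<omega> = g 1 (past \<omega>)"
    using g_version[of 0] g_version[of 1] by auto
  ultimately show ?thesis by eventually_elim simp
qed

text \<open>
  The identity holds almost surely, hence somewhere in every cylinder, hence everywhere by
  continuity.
\<close>

lemma g_sum:
  assumes x: "x \<in> space (Seq (-1))"
  shows "g 0 x + g 1 x = 1"
proof -
  let ?s = "g 0 x + g 1 x"
  \<comment> \<open>Comparing \<open>x\<close> with a good point of its cylinder in both directions
    gives a lower and an upper bound, which force the sum to be 1 as \<open>p\<close> grows.\<close>
  have *: "1 - gamma_coeff g p \<le> ?s \<and> (1 - gamma_coeff g p) * ?s \<le> 1" for p
  proof -
    let ?J = "{- int p..-1}"
    let ?E = "{\<omega> \<in> space M. \<forall>n\<in>?J. X n \<omega> = x n}"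
    have "x \<in> ?J \<rightarrow> {0, 1}" using x by (auto simp: space_Seq PiE_iff)
    then have "0 < measure M ?E" using pos_cyl unfolding positive_cylinders_def by force
    then have pos: "measure M ?E \<noteq> 0" by simp
    have "\<not> (AE \<omega> in M. \<omega> \<notin> ?E)"
    proof
      assume "AE \<omega> in M. \<omega> \<notin> ?E"
      moreover have "?E \<in> sets M" using pos measure_notin_sets by blast
      ultimately have "?E \<in> null_sets M" by (simp only: AE_iff_null_sets)
      then show False using pos measure_eq_0_null_sets by blast

    qed
    moreover have "AE \<omega> in M. \<omega> \<notin> ?E"
      if "AE \<omega> in M. \<not> (\<omega> \<in> ?E \<and> g 0 (past \<omega>) + g 1 (past \<omega>) = 1)"
      using that AE_g_sum by eventually_elim blast
    ultimately have not_AE: "\<not> (AE \<omega> in M. \<not> (\<omega> \<in> ?E \<and> g 0 (past \<omega>) + g 1 (past \<omega>) = 1))"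
      by blast
    have "\<exists>\<omega>. \<omega> \<in> ?E \<and> g 0 (past \<omega>) + g 1 (past \<omega>) = 1"
    proof (rule ccontr)
      assume none: "\<nexists>\<omega>. \<omega> \<in> ?E \<and> g 0 (past \<omega>) + g 1 (past \<omega>) = 1"
      have "AE \<omega> in M. \<not> (\<omega> \<in> ?E \<and> g 0 (past \<omega>) + g 1 (past \<omega>) = 1)"
        by (rule AE_I2) (use none in blast)
      with not_AE show False by contradiction
    qed
    then obtain
 \<omega> where \<omega>: "\<omega> \<in> ?E" "g 0 (past \<omega>) + g 1 (past \<omega>) = 1"
      by blast

    have y: "past \<omega> \<in> space (Seq (-1))" using \<omega> past_space by simp
    have agree: "past \<omega> n = x n" if "n \<in> ?J" for n using \<omega> that by (auto simp: path_def)
    let ?a = "1 - gamma_coeff g p"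
    have "?a * g 0 (past \<omega>) \<le> g 0 x" "?a * g 1 (past \<omega>) \<le> g 1 x"
      using ratio_Inf(3)[OF _ x y] agree by auto
    then have "?a * (g 0 (past \<omega>) + g 1 (past \<omega>)) \<le> ?s" by (simp add: algebra_simps)
    moreover have "?a * g 0 x \<le> g 0 (past \<omega>)" "?a * g 1 x \<le> g 1 (past \<omega>)"
      using ratio_Inf(3)[OF _ y x] agree by auto
    then have "?a * ?s \<le> g 0 (past \<omega>) + g 1 (past \<omega>)" by (simp add: algebra_simps)
    ultimately show ?thesis unfolding \<omega>(2) by simp
  qed
  have lim: "(\<lambda>p. 1 - gamma_coeff g p) \<longlonglongrightarrow> 1"
    using tendsto_diff[OF tendsto_const[of 1] gamma_lim] by simp
  have "1 \<le> ?s" using * by (intro LIMSEQ_le_const2[OF lim]) auto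
  moreover have "1 * ?s \<le> 1"
    using * by (intro LIMSEQ_le_const2[OF tendsto_mult[OF lim tendsto_const]]) auto
  ultimately show ?thesis by simp
qed

sublocale binary_kernel "g 1"
proof
  show "g 1 \<in> borel_measurable (Seq (-1))" by (rule g_meas) simp
  fix x assume x: "x \<in> space (Seq (-1))"
  show "0 \<le> g 1 x" using g_pos[of 1 x] x by simp
  show "g 1 x \<le> 1" using g_sum[OF x] g_pos[of 0 x] x by simp
qed

text \<open>The coefficients control ratios, whereas determination is governed by the oscillation of
  \<open>g 1\<close> over a cylinder. Ratio bounds for both symbols are combined through
  \<open>g_sum\<close>.\<close>

lemma oscillation:
  assumes w: "set w \<subseteq> {0, 1}"
  shows "1 - gamma_coeff g (length w) \<le> 1 - (hi w - lo w)"
proof -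
  let ?a = "1 - gamma_coeff g (length w)"
  have *: "g 1 x \<le> g 1 y + (1 - ?a)" if "x \<in> cyl w" "y \<in> cyl w" for x y
  proof -
    have sp: "x \<in> space (Seq (-1))" "y \<in> space (Seq (-1))" using that by (auto simp: cyl_def)
    have agree: "x n = y n" if n: "n \<in> {- int (length w)..-1}" for n
    proof -
      have "nat (-1 - n) < length w" "n = -1 - int (nat (-1 - n))" using n by auto
      then show ?thesis using \<open>x \<in> cyl w\<close> \<open>y \<in> cyl w\<close> unfolding cyl_def by (metis (mono_tags, lifting) mem_Collect_eq)
    qed
    have "?a * g 1 x \<le> g 1 y" using agree by (intro ratio_Inf(3) sp) auto
    moreover have "?a * g 0 y \<le> g 0 x" using agree by (intro ratio_Inf(3) sp) auto
    then have "?a * (1 - g 1 y) \<le> 1 - g 1 x"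
      using g_sum[OF sp(1)] g_sum[OF sp(2)] by (metis add_diff_cancel_right')
    \<comment> \<open>With \<open>d = g 1 x - g 1 y\<close>, adding the two ratio bounds gives
      \<open>?a * (1 + d) \<le> 1 - d\<close>, hence \<open>d \<le> 1 - ?a\<close> for
      \<open>d \<ge> 0\<close>; for negative \<open>d\<close> this follows from
      \<open>?a \<le> 1\<close>.\<close>
    ultimately have "?a + ?a * (g 1 x - g 1 y) \<le> 1 - (g 1 x - g 1 y)" by (simp add: algebra_simps)
    moreover have "0 \<le> ?a * (g 1 x - g 1 y)" if "g 1 y \<le> g 1 x"
      using ratio_Inf(1) that by simp
    ultimately show ?thesis using ratio_Inf(2)[of "length w"] by (cases "g 1 y \<le> g 1 x") auto
  qed
  have ne: "cyl w \<noteq> {}" by (rule cyl_nonempty[OF w])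
  have "hi w \<le> g 1 y + (1 - ?a)" if "y \<in> cyl w" for y
    unfolding hi_def using ne * that by (intro cSup_least) auto
  then have "hi w - (1 - ?a) \<le> lo w"
    unfolding lo_def using ne by (intro cInf_greatest) (auto simp: diff_le_eq)
  then show ?thesis by simp
qed

text \<open>An index shift: the products of the hypothesis begin with the factor at 0, those of the
  house-of-cards chain with the empty product. One additional term does not affect
  divergence.\<close>

lemma product_divergence: "(\<Sum>j. ennreal (\<Prod>p<j. 1 - gamma_coeff g p)) = \<infinity>"
proof -
  let ?f = "\<lambda>j. ennreal (\<Prod>p<j. 1 - gamma_coeff g p)"
  have "{0..l} = {..<Suc l}" for l :: nat by auto
  then have "(\<Sum>l. ?f (Suc l)) = \<infinity>" using gamma_div by simp
  then have "(\<lambda>l. ?f (Suc l)) sums \<infinity>" by (metis summableI summable_sums)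
  then have "?f sums (\<infinity> + ?f 0)" by (rule sums_Suc)
  then show ?thesis using sums_unique by fastforce
qed

section \<open>Invariance of the law of the past\<close>

definition "past_law = distr M (Seq (-1)) past"

lemma prob_space_past_law: "prob_space past_law"
  unfolding past_law_def by (intro prob_space_distr path_meas) simp

lemma sets_past_law [simp]: "sets past_law = sets (Seq (-1))"
  by (simp add: past_law_def)

text \<open>Stationarity is used for a shift by one: a path ending at 0 and one ending at
  \<open>-1\<close> have the same law after re-indexing. Hence adding the symbol at time 0 leaves
  the law of the past unchanged.\<close>

lemma process_law_eq: "process_law M X = distr past_law (Seq 0) (\<lambda>x. \<lambda>n\<in>{..0}. x (n - 1))"
  and past_law_push: "past_law = distr M (Seq (-1)) (\<lambda>\<omega>. push (X 0 \<omega>) (past \<omega>))"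
proof -
  let ?Y = "\<lambda>n. X (n - 1)"
  let ?up = "\<lambda>x. \<lambda>n\<in>{..0::int}. x (n - 1) :: nat"
  let ?down = "\<lambda>x. \<lambda>n\<in>{..-1::int}. x (n + 1) :: nat"
  have up: "?up \<in> measurable (Seq (-1)) (Seq 0)" and down: "?down \<in> measurable (Seq 0) (Seq (-1))"
    unfolding Seq_def by (intro measurable_restrict measurable_component_singleton; simp)+
  have law: "process_law M X = distr M (Seq 0) (path ?Y 0)"
    using stat[unfolded stationary_def, rule_format, of 1] by (simp add: process_law_def)
  have Y: "path ?Y 0 \<in> measurable M (Seq 0)"
    unfolding path_def Seq_def by (intro measurable_restrict X_meas) auto
  have "?up \<circ> past = path ?Y 0" by (auto simp: path_def fun_eq_iff)
  then show "process_law M X = distr past_law (Seq 0) ?up"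
    unfolding law past_law_def by (subst distr_distr[OF up path_meas]) auto
  have "past_law = distr (process_law M X) (Seq (-1)) ?down"
    unfolding law past_law_def
    by (subst distr_distr[OF down Y]) (auto simp: path_def fun_eq_iff intro!: distr_cong)
  also have "\<dots> = distr M (Seq (-1)) (\<lambda>\<omega>. push (X 0 \<omega>) (past \<omega>))"
    unfolding process_law_def
    by (subst distr_distr[OF down path_meas]) (auto simp: path_def push_def fun_eq_iff intro!: distr_cong)
  finally show "past_law = distr M (Seq (-1)) (\<lambda>\<omega>. push (X 0 \<omega>) (past \<omega>))" .
qed

text \<open>The defining property of conditional probability, tested on an event of the past and
  transported to \<open>past_law\<close>.\<close>

lemma emeasure_past_and_symbol:
  assumes i: "i \<in> {0, 1}" and A: "A \<in> sets (Seq (-1))"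
  shows "emeasure M {\<omega> \<in> space M. past \<omega> \<in> A \<and> X 0 \<omega> = i}
    = (\<integral>\<^sup>+x. ennreal (g i x) * indicator A x \<partial>past_law)"
proof -
  interpret P: sigma_finite_subalgebra M past_alg by (rule sigma_finite_past_alg)
  let ?E = "{\<omega> \<in> space M. X 0 \<omega> = i}" and ?B = "past -` A \<inter> space M"
  let ?h = "\<lambda>\<omega>. g i (past \<omega>)"
  have E: "?E \<in> sets M" by (rule event_sets[OF i])
  have past_m: "past \<in> measurable M (Seq (-1))" by (rule path_meas) simp
  have B: "?B \<in> sets past_alg"
    using measurable_sets[OF past_meas_alg A] by (simp add: space_natural_filtration)
  then have BM: "?B \<in> sets M" using past_alg_sub by (auto simp: subalgebra_def)
  have h_m: "?h \<in> borel_measurable M" by (rule measurable_compose[OF past_m g_meas[OF i]])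
  have int: "integrable M (indicator ?E :: 'a \<Rightarrow> real)" using E by (simp add: emeasure_eq_measure)
  have h_int: "integrable M ?h"
    by (rule integrable_cong_AE_imp[OF P.real_cond_exp_int(1)[OF int] h_m])
      (use g_version[OF i] in \<open>auto elim: eventually_mono\<close>)
  have h_ge0: "0 \<le> ?h \<omega>" if "\<omega> \<in> space M" for \<omega>
    using g_pos[OF i past_space[OF that]] by simp
  have "measure M (?B \<inter> ?E) = (\<integral>\<omega>\<in>?B. indicator ?E \<omega> \<partial>M)"
    using BM E by (simp add: set_lebesgue_integral_def indicator_inter_arith[symmetric])
  also have "\<dots> = (\<integral>\<omega>\<in>?B. real_cond_exp M past_alg (indicator ?E) \<omega> \<partial>M)"
    by (rule P.real_cond_exp_intA[OF int B])
  also have "\<dots> = (\<integral>\<omega>. indicator ?B \<omega> * ?h \<omega> \<partial>M)"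
    unfolding set_lebesgue_integral_def
    by (rule integral_cong_AE) (use g_version[OF i] BM h_m in auto)
  finally have "emeasure M (?B \<inter> ?E) = ennreal (\<integral>\<omega>. indicator ?B \<omega> * ?h \<omega> \<partial>M)"
    by (simp add: emeasure_eq_measure)
  also have "\<dots> = (\<integral>\<^sup>+\<omega>. ennreal (indicator ?B \<omega> * ?h \<omega>) \<partial>M)"
    using h_ge0 integrable_mult_indicator[OF BM h_int]
    by (intro nn_integral_eq_integral[symmetric]) auto
  also have "\<dots> = (\<integral>\<^sup>+\<omega>. ennreal (g i (past \<omega>)) * indicator A (past \<omega>) \<partial>M)"
    by (intro nn_integral_cong) (auto simp: indicator_def)
  also have "\<dots> = (\<integral>\<^sup>+x. ennreal (g i x) * indicator A x \<partial>past_law)"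
    unfolding past_law_def using A g_meas[OF i] by (intro nn_integral_distr[OF past_m, symmetric]) auto
  also have "?B \<inter> ?E = {\<omega> \<in> space M. past \<omega> \<in> A \<and> X 0 \<omega> = i}" by auto
  finally show ?thesis .
qed

text \<open>Sampling the next symbol by a uniform threshold reproduces the joint law of the past and
  the symbol at time 0, and by stationarity the extended past again has law
  \<open>past_law\<close>.\<close>

lemma past_law_upd: "past_law = distr (past_law \<Otimes>\<^sub>M unif) (Seq (-1)) (\<lambda>(x, u). upd x u)"
proof (rule measure_eqI)
  interpret U: prob_space unif by (rule prob_space_unif)
  interpret L: prob_space past_law by (rule prob_space_past_law)
  show "sets past_law = sets (distr (past_law \<Otimes>\<^sub>M unif) (Seq (-1)) (\<lambda>(x, u). upd x u))" by simp
  fix E assume "E \<in> sets past_law"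
  then have E: "E \<in> sets (Seq (-1))" by simp
  \<comment> \<open>The event is split by the newest symbol: \<open>?A i\<close> collects the pasts
    that enter \<open>E\<close> when \<open>i\<close> is appended.\<close>
  let ?A = "\<lambda>i. push i -` E \<inter> space (Seq (-1))"
  have A: "?A i \<in> sets (Seq (-1))" if "i \<in> {0, 1}" for i
    by (rule measurable_sets[OF push_measurable[OF that] E])
  have past_m: "past \<in> measurable M (Seq (-1))" by (rule path_meas) simp
  let ?D = "\<lambda>i. {\<omega> \<in> space M. past \<omega> \<in> ?A i \<and> X 0 \<omega> = i}"
  have D: "?D i \<in> sets M" if "i \<in> {0, 1}" for i
  proof -
    have "?D i = (past -` ?A i \<inter> space M) \<inter> {\<omega> \<in> space M. X 0 \<omega> = i}" by auto
    then show ?thesis using measurable_sets[OF past_m A[OF that]] event_sets[OF that] by simp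
  qed
  have push_m: "(\<lambda>\<omega>. push (X 0 \<omega>) (past \<omega>)) \<in> measurable M (Seq (-1))"
  proof -

    have "(\<lambda>\<omega>. push (X 0 \<omega>) (past \<omega>)) = (\<lambda>\<omega>. \<lambda>n\<in>{..-1}. X (n + 1) \<omega>)"
      by (auto simp: push_def path_def fun_eq_iff)
    also have "\<dots> \<in> measurable M (Seq (-1))"
      unfolding Seq_def by (intro measurable_restrict X_meas) auto
    finally show ?thesis .
  qed
  have "emeasure past_law E = emeasure M ((\<lambda>\<omega>. push (X 0 \<omega>) (past \<omega>)) -` E \<inter> space M)"
    by (subst past_law_push) (rule emeasure_distr[OF push_m E])
  also have "(\<lambda>\<omega>. push (X 0 \<omega>) (past \<omega>)) -` E \<inter> space M = ?D 1 \<union> ?D 0"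
  proof (rule set_eqI)
    fix \<omega>
    show "\<omega> \<in> (\<lambda>\<omega>. push (X 0 \<omega>) (past \<omega>)) -` E \<inter> space M \<longleftrightarrow> \<omega> \<in> ?D 1 \<union> ?D 0"
      using X_bin[of 0 \<omega>] past_space[of \<omega>] by (cases "X 0 \<omega> = 0") auto
  qed
  also have "emeasure M (?D 1 \<union> ?D 0) = emeasure M (?D 1) + emeasure M (?D 0)"
    using D by (intro plus_emeasure[symmetric]) auto
  also have "\<dots> = (\<integral>\<^sup>+x. ennreal (g 1 x) * indicator (?A 1) x \<partial>past_law)
      + (\<integral>\<^sup>+x. ennreal (g 0 x) * indicator (?A 0) x \<partial>past_law)"
    using A by (simp only: emeasure_past_and_symbol insert_iff simp_thms)
  also have "\<dots> = (\<integral>\<^sup>+x. ennreal (g 1 x) * indicator (?A 1) x + ennreal (g 0 x) * indicator (?A 0) x \<partial>past_law)"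
    using A g_meas by (intro nn_integral_add[symmetric] borel_measurable_times_ennreal
        measurable_ennreal borel_measurable_indicator) (simp_all cong: measurable_cong_sets)
  also have "\<dots> = (\<integral>\<^sup>+x. (\<integral>\<^sup>+u. indicator E (upd x u) \<partial>unif) \<partial>past_law)"
  proof (rule nn_integral_cong)
    fix x assume "x \<in> space past_law"
    then have x: "x \<in> space (Seq (-1))" using sets_eq_imp_space_eq[OF sets_past_law] by simp
    have "(\<integral>\<^sup>+u. indicator E (upd x u) \<partial>unif)
        = (\<integral>\<^sup>+u. (if u < g 1 x then indicator E (push 1 x) else indicator E (push 0 x)) \<partial>unif)"
      unfolding upd_def by (rule nn_integral_cong) simp
    also have "\<dots> = ennreal (g 1 x) * indicator E (push 1 x) + ennreal (1 - g 1 x) * indicator E (push 0 x)"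
      by (rule nn_integral_unif_threshold[OF q_ge0[OF x] q_le1[OF x]])
    \<comment> \<open>The threshold gives symbol 0 the weight \<open>1 - g 1 x\<close>, which is
      \<open>g 0 x\<close> at every past and not just almost everywhere.\<close>
    also have "1 - g 1 x = g 0 x" using g_sum[OF x] by simp
    finally show "ennreal (g 1 x) * indicator (?A 1) x + ennreal (g 0 x) * indicator (?A 0) x
        = (\<integral>\<^sup>+u. indicator E (upd x u) \<partial>unif)"
      using x by (simp add: indicator_def)
  qed
  also have "\<dots> = (\<integral>\<^sup>+p. indicator E (case p of (x, u) \<Rightarrow> upd x u) \<partial>(past_law \<Otimes>\<^sub>M unif))"
  proof -
    have "(\<lambda>p. indicator E (case p of (x, u) \<Rightarrow> upd x u) :: ennreal) \<in> borel_measurable (past_law \<Otimes>\<^sub>M unif)"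
      by (rule measurable_compose[OF _ borel_measurable_indicator[OF E]])
        (use upd_measurable in \<open>simp cong: measurable_cong_sets sets_pair_measure_cong\<close>)
    from U.nn_integral_fst[OF this] show ?thesis by simp
  qed
  also have "\<dots> = emeasure (distr (past_law \<Otimes>\<^sub>M unif) (Seq (-1)) (\<lambda>(x, u). upd x u)) E"
  proof -
    have m: "(\<lambda>(x, u). upd x u) \<in> measurable (past_law \<Otimes>\<^sub>M unif) (Seq (-1))"
      using upd_measurable by (simp cong: measurable_cong_sets sets_pair_measure_cong)
    show ?thesis
      using nn_integral_distr[OF m, of "indicator E"] E by simp
  qed
  finally show "emeasure past_law E = emeasure (distr (past_law \<Otimes>\<^sub>M unif) (Seq (-1)) (\<lambda>(x, u). upd x u)) E" .
qed

lemma past_law_invariant: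
  assumes f: "f \<in> borel_measurable (Seq (-1))"
  shows "(\<integral>\<^sup>+x. past_op f x \<partial>past_law) = (\<integral>\<^sup>+x. f x \<partial>past_law)"
proof -
  interpret U: prob_space unif by (rule prob_space_unif)
  have m: "(\<lambda>(x, u). upd x u) \<in> measurable (past_law \<Otimes>\<^sub>M unif) (Seq (-1))"
    using upd_measurable by (simp cong: measurable_cong_sets sets_pair_measure_cong)
  have "(\<integral>\<^sup>+x. past_op f x \<partial>past_law) = (\<integral>\<^sup>+p. f (case p of (x, u) \<Rightarrow> upd x u) \<partial>(past_law \<Otimes>\<^sub>M unif))"
    unfolding past_op_def using U.nn_integral_fst[OF measurable_compose[OF m f]] by simp

  also have "\<dots> = (\<integral>\<^sup>+x. f x \<partial>distr (past_law \<Otimes>\<^sub>M unif) (Seq (-1)) (\<lambda>(x, u). upd x u))"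
    using f by (intro nn_integral_distr[OF m, symmetric]) simp
  finally show ?thesis unfolding past_law_upd[symmetric] .
qed

end

section \<open>Realisation of the copy and conclusion\<close>

lemma (in forgetful_kernel) process_law_X_lim:
  "process_law N X_lim = distr (distr N (Seq (-1)) (past_lim 0)) (Seq 0) (\<lambda>x. \<lambda>n\<in>{..0}. x (n - 1))"
proof -
  have up: "(\<lambda>x. \<lambda>n\<in>{..0}. x (n - 1)) \<in> measurable (Seq (-1)) (Seq 0)"
    unfolding Seq_def by (intro measurable_restrict measurable_component_singleton; simp)
  have past_m: "past_lim 0 \<in> measurable N (Seq (-1))" by (rule past_lim_measurable) simp
  have "path X_lim 0 = (\<lambda>x. \<lambda>n\<in>{..0}. x (n - 1)) \<circ> past_lim 0"
    by (auto simp: path_def lim_past_def fun_eq_iff)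
  then show ?thesis
    unfolding process_law_def by (subst distr_distr[OF up past_m]) simp
qed

text \<open>The type of the sample space is prescribed by
  \<open>standard_natural_filtration\<close>. The first component of each pair is frozen at 0, and
  the real component carries the uniform variable.\<close>

lemma exists_iid_uniform:

  "\<exists>(N :: (int \<Rightarrow> nat \<times> real) measure) W. prob_space N \<and> iid_uniform N W"
proof -
  interpret U: prob_space unif by (rule prob_space_unif)
  define Q where "Q = distr unif (count_space (UNIV :: nat set) \<Otimes>\<^sub>M borel) (Pair (0 :: nat))"
  have P0: "Pair (0 :: nat) \<in> measurable unif (count_space (UNIV :: nat set) \<Otimes>\<^sub>M borel)"
    by (simp cong: measurable_cong_sets)
  have snd_Q: "snd \<in> measurable Q borel" unfolding Q_def by simp
  have Q: "prob_space Q" unfolding Q_def by (rule U.prob_space_distr[OF P0])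
  define N where "N = PiM {..0::int} (\<lambda>_. Q)"
  interpret N: prob_space N unfolding N_def by (rule prob_space_PiM) (rule Q)
  have comp: "distr N Q (\<lambda>\<omega>. \<omega> n) = Q" if "n \<le> 0" for n
    unfolding N_def using that distr_PiM_component[of "{..0}" "\<lambda>_. Q" n] Q by simp
  have comp_m: "(\<lambda>\<omega>. \<omega> n) \<in> measurable N Q" if "n \<le> 0" for n
    unfolding N_def using that by simp
  have "N.indep_vars (\<lambda>_. Q) (\<lambda>n \<omega>. \<omega> n) {..0}"
  proof (subst N.indep_vars_iff_distr_eq_PiM')
    have "distr N (PiM {..0} (\<lambda>_. Q)) (\<lambda>x. \<lambda>i\<in>{..0}. x i) = distr N N (\<lambda>x. x)"
      by (rule distr_cong) (auto simp: N_def space_PiM PiE_iff extensional_restrict)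
    also have "\<dots> = N" by (rule distr_id)
    also have "\<dots> = PiM {..0} (\<lambda>i. distr N Q (\<lambda>\<omega>. \<omega> i))"
      unfolding N_def by (rule PiM_cong) (use comp in \<open>auto simp: N_def\<close>)
    finally show "distr N (PiM {..0} (\<lambda>_. Q)) (\<lambda>x. \<lambda>i\<in>{..0}. x i) = PiM {..0} (\<lambda>i. distr N Q (\<lambda>\<omega>. \<omega> i))" .
  qed (use comp_m in auto)
  from N.indep_vars_compose2[OF this, of "\<lambda>_. snd" "\<lambda>_. borel"] snd_Q
  have "N.indep_vars (\<lambda>_. borel) (\<lambda>n \<omega>. snd (\<omega> n)) {..0}" by simp
  moreover have "distr N borel (\<lambda>\<omega>. snd (\<omega> n)) = unif" if "n \<le> 0" for n
  proof -
    have "distr N borel (\<lambda>\<omega>. snd (\<omega> n)) = distr Q borel snd"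
      using distr_distr[OF snd_Q comp_m[OF that]] comp[OF that] by (simp add: comp_def)
    also have "\<dots> = distr unif borel (\<lambda>x. x)"
      unfolding Q_def by (subst distr_distr[OF _ P0]) (simp_all add: comp_def)
    also have "\<dots> = unif" by (rule distr_id2) simp
    finally show ?thesis .
  qed
  ultimately have "iid_uniform N (\<lambda>n \<omega>. snd (\<omega> n))" by (simp add: iid_uniform_def)
  then show ?thesis using N.prob_space_axioms by blast
qed

theorem theorem3:
  fixes M :: "'a measure"
    and X :: "int \<Rightarrow> 'a \<Rightarrow> nat"
    and g :: "nat \<Rightarrow> (int \<Rightarrow> nat) \<Rightarrow> real"
  assumes "prob_space M"
    and "binary_process M X"
    and "stationary M X"
    and "positive_cylinders M X"
    and "cond_prob_version M X g"
    and "\<And>i x. i \<in> {0, 1} \<Longrightarrow> x \<in> space (Seq (-1)) \<Longrightarrow> 0 < g i x"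
    and "gamma_coeff g \<longlonglongrightarrow> 0"
    and "(\<Sum>l. ennreal (\<Prod>p=0..l. 1 - gamma_coeff g p)) = \<infinity>"
  shows "standard_natural_filtration M X"
proof -
  interpret complete_connections M X g
    by (intro complete_connections.intro complete_connections_axioms.intro assms)
  obtain N :: "(int \<Rightarrow> nat \<times> real) measure" and W where N: "prob_space N" "iid_uniform N W"
    using exists_iid_uniform by blast
  \<comment> \<open>The symbol 1 is drawn with probability \<open>g 1\<close>, and
    \<open>oscillation\<close> justifies the growth bounds
    \<open>1 - gamma_coeff g p\<close>.\<close>
  interpret K: forgetful_kernel "g 1" N W "\<lambda>p. 1 - gamma_coeff g p"
    by (intro forgetful_kernel.intro driven_kernel.intro driven_kernel_axioms.intro
        forgetful_kernel_axioms.intro binary_kernel_axioms N ratio_Inf(1) oscillation product_divergence)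
  have law: "process_law N K.X_lim = process_law M X"
  proof -
    have "distr N (Seq (-1)) (K.past_lim 0) = past_law"
      by (rule K.distr_past_lim[OF prob_space_past_law sets_past_law]) (rule past_law_invariant)
    \<comment> \<open>Both process laws are images under the same re-indexing map, so equality of
      the laws of the pasts suffices.\<close>
    then show ?thesis unfolding K.process_law_X_lim process_law_eq by (rule arg_cong)
  qed

  show ?thesis
    unfolding standard_natural_filtration_def
  proof (intro exI conjI)
    show "binary_process N K.X_lim" using K.X_lim_measurable_N by (simp add: binary_process_def)
    show "diffusive_product_type N K.W_alg" using N(2) by (auto simp: diffusive_product_type_def)
  qed (fact N(1) law K.immersed_X_W)+
qed

end
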